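(* Let $D$ be an oriented diagram of a knot. If $\Delta(D)=0$ then $s(D)=U(D)$. More generally, $$U(D)-2\Delta(D)\leq s(D)\leq U(D).$$
   Context: Rasmussen invariant: for a diagram $D$ of a knot $K$, consider Lee's filtered chain complex $\mathscr{F}^jC^i(D)$ with complex coefficients, i.e. the perturbed Khovanov complex built from the Frobenius algebra $\mathbb{C}\hookrightarrow \mathbb{C}[x]/(x^2-1)$, where $i$ is the homological grading and $\cdots\subseteq\mathscr{F}^{j+1}C^i\subseteq\mathscr{F}^jC^i\subseteq\cdots$ is the quantum filtration. Its homology is 2-dimensional, supported in $i=0$, and generated by Lee's canonical classes $[\mathfrak{s}_o],[\mathfrak{s}_{\bar o}]$ associated with the orientation $o$ of $D$ and the reverse orientation. Let $s_{\min}(D)$ be the largest $j$ such that $[\mathfrak{s}_o]$ (equivalently $[\mathfrak{s}_{\bar o}]$) lies in $\mathscr{F}^jH^0(D)$. Then $s(D)=s(K)=s_{\min}(D)+1\in 2\mathbb{Z}$. This depends only on $K$, and with this normalization $s(K)=2g^*(K)$ for positive knots, where $g^*$ is the smooth slice genus. Seifert graph: let $O(D)$ be the oriented resolution of $D$ (every crossing is smoothed respecting orientation), a disjoint union of circles. The Seifert graph $T(D)$ has one node for each circle of $O(D)$ and, for each positive (respectively negative) crossing of $D$, one edge decorated with $+$ (respectively $-$) joining the two distinct circles on which the smoothed crossing lies. The subgraph $T^-(D)$ (respectively $T^+(D)$) is obtained from $T(D)$ by removing all edges decorated with $+$ (respectively $-$), keeping all nodes. Let $w(D)$ be the writhe of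 $D$ (number of positive crossings minus number of negative crossings). Define $$U(D)=\#\mathrm{nodes}(T(D))-2\,\#\mathrm{components}(T^-(D))+w(D)+1 ,$$ $$\Delta(D)=\#\mathrm{nodes}(T(D))-\#\mathrm{components}(T^-(D))-\#\mathrm{components}(T^+(D))+1 .$$ *)

theory Defs
  imports Complex_Main
begin

text \<open>The classes of the equivalence relation on \<open>S\<close> generated by \<open>R \<subseteq> S \<times> S\<close>.\<close>

definition classes :: "'a set \<Rightarrow> 'a rel \<Rightarrow> 'a set set" where
  "classes S R = S // (R \<union> R\<inverse>)\<^sup>*"

section \<open>Oriented knot diagrams in the plane\<close>

text \<open>
  A diagram with \<open>n\<close> crossings is given by an oriented planar diagram code. The crossings cut the
  knot into \<open>2 * n\<close> arcs, numbered \<open>0, ..., 2 * n - 1\<close> in the order in which the orientation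
  traverses them; without crossings there is a single closed arc \<open>0\<close>. A crossing records its sign
  and its four arcs. An arc has a left (\<open>True\<close>) and a right (\<open>False\<close>) side with
  respect to the orientation. The order of the crossings in the list is only used for the signs in
  the cube of resolutions.
\<close>

record crossing =
  positive :: bool
  under_in :: nat
  under_out :: nat
  over_in :: nat
  over_out :: nat

type_synonym side = "nat \<times> bool"

record diagram =
  crossings :: "crossing list"
  outer :: side  \<comment> \<open>some side of an arc that faces the unbounded region\<close>

abbreviation n_crossings :: "diagram \<Rightarrow> nat" where
  "n_crossings D \<equiv> length (crossings D)"

abbreviation crossing_at :: "diagram \<Rightarrow> nat \<Rightarrow> crossing" where
  "crossing_at D k \<equiv> crossings D ! k"

definition arcs :: "diagram \<Rightarrow> nat set" where
  "arcs D = {..<max 1 (2 * n_crossings D)}"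

definition sides :: "diagram \<Rightarrow> side set" where
  "sides D = arcs D \<times> UNIV"

text \<open>
  The four corners at a crossing, each given by the two sides that bound it. Draw the lower strand
  from south to north: the upper strand then runs from west to east if the crossing is positive and
  from east to west if it is negative. The corners are listed in the order SW, SE, NE, NW.
\<close>

definition corners :: "crossing \<Rightarrow> side rel" where
  "corners c =
    (if positive c
     then {((under_in c, True), (over_in c, False)), ((under_in c, False), (over_out c, False)),
           ((under_out c, False), (over_out c, True)), ((under_out c, True), (over_in c, True))}
     else {((under_in c, True), (over_out c, True)), ((under_in c, False), (over_in c, True)),
           ((under_out c, False), (over_in c, False)), ((under_out c, True), (over_out c, False))})"

definition faces :: "diagram \<Rightarrow> side set set" where
  "faces D = classes (sides D) (\<Union>c\<in>set (crossings D). corners c)"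

text \<open>
  The underlying 4-valent graph is connected with \<open>n\<close> vertices and \<open>2 * n\<close> edges, so by Euler's
  formula the surface obtained by glueing in the faces is a sphere iff there are \<open>n + 2\<close> faces.
  This excludes virtual diagrams.
\<close>

definition knot_diagram :: "diagram \<Rightarrow> bool" where
  "knot_diagram D \<longleftrightarrow>
     distinct (map under_in (crossings D) @ map over_in (crossings D)) \<and>
     set (map under_in (crossings D) @ map over_in (crossings D)) = {..<2 * n_crossings D} \<and>
     (\<forall>c\<in>set (crossings D).
        under_out c = Suc (under_in c) mod (2 * n_crossings D) \<and>
        over_out c = Suc (over_in c) mod (2 * n_crossings D)) \<and>
     card (faces D) = n_crossings D + 2 \<and>
     outer D \<in> sides D"

definition positive_crossings :: "diagram \<Rightarrow> nat set" where
  "positive_crossings D = {k. k < n_crossings D \<and> positive (crossing_at D k)}"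

definition negative_crossings :: "diagram \<Rightarrow> nat set" where
  "negative_crossings D = {k. k < n_crossings D \<and> \<not> positive (crossing_at D k)}"

definition writhe :: "diagram \<Rightarrow> int" where
  "writhe D = int (card (positive_crossings D)) - int (card (negative_crossings D))"

section \<open>Resolutions\<close>

text \<open>
  The pairs of arcs joined by the 0-smoothing (\<open>b = False\<close>) and the 1-smoothing (\<open>b = True\<close>) of a
  crossing. The oriented smoothing is the 0-smoothing of a positive and the 1-smoothing of a
  negative crossing.
\<close>

definition smoothing :: "crossing \<Rightarrow> bool \<Rightarrow> nat rel" where
  "smoothing c b =
    (if positive c \<noteq> b
     then {(under_in c, over_out c), (over_in c, under_out c)}
     else {(under_in c, over_in c), (under_out c, over_out c)})"

text \<open>
  A vertex of the cube of resolutions is the set \<open>V\<close> of crossings that are 1-smoothed. A circle is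
  represented by the set of its arcs.
\<close>

definition circles :: "diagram \<Rightarrow> nat set \<Rightarrow> nat set set" where
  "circles D V = classes (arcs D) (\<Union>k<n_crossings D. smoothing (crossing_at D k) (k \<in> V))"

definition oriented_resolution :: "diagram \<Rightarrow> nat set set" where
  "oriented_resolution D = circles D (negative_crossings D)"

section \<open>Lee's filtered complex\<close>

text \<open>
  The basis \<open>1, x\<close> of the Frobenius algebra \<open>\<complex>[x]/(x\<^sup>2 - 1)\<close>. All structure constants
  are 0 or 1, so the product of two basis elements is a basis element and a coproduct is
  given by the set of tensors of which it is the sum.
\<close>

datatype label = One | X

fun label_mult :: "label \<Rightarrow> label \<Rightarrow> label" where
  "label_mult One q = q"
| "label_mult X One = X"
| "label_mult X X = One"

fun label_comult :: "label \<Rightarrow> (label \<times> label) set" where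
  "label_comult One = {(One, X), (X, One)}"
| "label_comult X = {(X, X), (One, One)}"

text \<open>
  A basis element of the chain group is a pair \<open>(V, S)\<close> where \<open>S\<close> is the set of those circles of
  the resolution \<open>V\<close> that are labelled \<open>x\<close>, the others being labelled \<open>1\<close>. A chain is its family
  of coefficients.
\<close>

type_synonym state = "nat set \<times> nat set set"
type_synonym chain = "state \<Rightarrow> complex"

definition states :: "diagram \<Rightarrow> state set" where
  "states D = {(V, S). V \<subseteq> {..<n_crossings D} \<and> S \<subseteq> circles D V}"

definition label_of :: "nat set set \<Rightarrow> nat set \<Rightarrow> label" where
  "label_of S C = (if C \<in> S then X else One)"

fun hdeg :: "diagram \<Rightarrow> state \<Rightarrow> int" where
  "hdeg D (V, S) = int (card V) - int (card (negative_crossings D))"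

text \<open>
  The labels \<open>1\<close> and \<open>x\<close> have degree 1 and -1. The shift is such that a positive trefoil has
  \<open>s = 2\<close>.
\<close>

fun qdeg :: "diagram \<Rightarrow> state \<Rightarrow> int" where
  "qdeg D (V, S) =
     int (card (circles D V - S)) - int (card S) + hdeg D (V, S) + writhe D"

definition chains :: "diagram \<Rightarrow> int \<Rightarrow> chain set" where
  "chains D i = {f. \<forall>\<sigma>. f \<sigma> \<noteq> 0 \<longrightarrow> \<sigma> \<in> states D \<and> hdeg D \<sigma> = i}"

definition filtered_chains :: "diagram \<Rightarrow> int \<Rightarrow> int \<Rightarrow> chain set" where
  "filtered_chains D j i = {f \<in> chains D i. \<forall>\<sigma>. f \<sigma> \<noteq> 0 \<longrightarrow> j \<le> qdeg D \<sigma>}"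

text \<open>
  The map along an edge of the cube from \<open>V\<close> to \<open>V'\<close> either merges two circles or splits one; the
  matrix entry from \<open>(V, S)\<close> to \<open>(V', S')\<close> is 1 if the following holds and 0 otherwise.
\<close>

definition edge_entry :: "diagram \<Rightarrow> state \<Rightarrow> state \<Rightarrow> bool" where
  "edge_entry D = (\<lambda>(V, S) (V', S').
     (\<forall>C\<in>circles D V \<inter> circles D V'. label_of S C = label_of S' C) \<and>
     (\<exists>A B M. A \<noteq> B \<and>
        (circles D V - circles D V' = {A, B} \<and> circles D V' - circles D V = {M} \<and>
           label_of S' M = label_mult (label_of S A) (label_of S B) \<or>
         circles D V - circles D V' = {M} \<and> circles D V' - circles D V = {A, B} \<and>
           (label_of S' A, label_of S' B) \<in> label_comult (label_of S M))))"

definition differential :: "diagram \<Rightarrow> chain \<Rightarrow> chain" where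
  "differential D f = (\<lambda>(V, S).
     if (V, S) \<in> states D
     then \<Sum>k\<in>V. (- 1) ^ card {l \<in> V. l < k} *
            (\<Sum>R | R \<subseteq> circles D (V - {k}) \<and> edge_entry D (V - {k}, R) (V, S). f (V - {k}, R))
     else 0)"

definition cycles :: "diagram \<Rightarrow> int \<Rightarrow> chain set" where
  "cycles D i = {f \<in> chains D i. differential D f = (\<lambda>_. 0)}"

definition boundaries :: "diagram \<Rightarrow> int \<Rightarrow> chain set" where
  "boundaries D i = differential D ` chains D (i - 1)"

definition homology_class :: "diagram \<Rightarrow> int \<Rightarrow> chain \<Rightarrow> chain set" where
  "homology_class D i z = {\<lambda>\<sigma>. z \<sigma> + b \<sigma> | b. b \<in> boundaries D i}"

text \<open>The filtration on homology: classes that are represented by a cycle of filtration level \<open>j\<close>.\<close>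

definition filtered_homology :: "diagram \<Rightarrow> int \<Rightarrow> int \<Rightarrow> chain set set" where
  "filtered_homology D j i = homology_class D i ` (cycles D i \<inter> filtered_chains D j i)"

section \<open>Lee's canonical generator\<close>

text \<open>
  Smoothing a crossing along the orientation joins two opposite corners. The oriented smoothing
  consists of the strands from \<open>under_in\<close> to \<open>over_out\<close> and from \<open>over_in\<close> to \<open>under_out\<close>; the
  new region between them is on the left of the former for a positive and on its right for a
  negative crossing.
\<close>

definition joined_corners :: "crossing \<Rightarrow> side rel" where
  "joined_corners c =
    (if positive c then {((under_in c, True), (under_out c, False))}
     else {((under_in c, False), (under_out c, True))})"

text \<open>
  Two sides are related iff they lie in the same component of the complement of the circle
  \<open>C\<close> of the oriented resolution, i.e. iff they can be connected while crossing only other circles.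
\<close>

definition same_side :: "diagram \<Rightarrow> nat set \<Rightarrow> side rel" where
  "same_side D C =
    (let R = (\<Union>c\<in>set (crossings D). corners c \<union> joined_corners c) \<union>
             {((e, True), (e, False)) | e. e \<in> arcs D - C}
     in (R \<union> R\<inverse>)\<^sup>*)"

definition separates_from_infinity :: "diagram \<Rightarrow> nat set \<Rightarrow> nat set \<Rightarrow> bool" where
  "separates_from_infinity D C' C \<longleftrightarrow>
     C' \<noteq> C \<and> (\<forall>e\<in>C. ((e, True), outer D) \<notin> same_side D C')"

text \<open>A circle is counterclockwise iff its inside is on its left.\<close>

definition counterclockwise :: "diagram \<Rightarrow> nat set \<Rightarrow> bool" where
  "counterclockwise D C \<longleftrightarrow> (\<forall>e\<in>C. ((e, True), outer D) \<notin> same_side D C)"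

definition nesting_number :: "diagram \<Rightarrow> nat set \<Rightarrow> nat" where
  "nesting_number D C =
     card {C' \<in> oriented_resolution D. separates_from_infinity D C' C} +
     (if counterclockwise D C then 1 else 0)"

text \<open>
  A circle of the oriented resolution is labelled \<open>x + 1\<close> if its nesting number is even and \<open>x - 1\<close>
  if it is odd. The canonical generator is the tensor product of these labels, written out in the
  basis of states.
\<close>

definition canonical_generator :: "diagram \<Rightarrow> chain" where
  "canonical_generator D = (\<lambda>(V, S).
     if V = negative_crossings D \<and> S \<subseteq> oriented_resolution D
     then \<Prod>C\<in>oriented_resolution D. if C \<in> S \<or> even (nesting_number D C) then 1 else - 1
     else 0)"

section \<open>Rasmussen's invariant\<close>

definition s_min :: "diagram \<Rightarrow> int" where
  "s_min D =
     (GREATEST j. homology_class D 0 (canonical_generator D) \<in> filtered_homology D j 0)"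

definition rasmussen_s :: "diagram \<Rightarrow> int" where
  "rasmussen_s D = s_min D + 1"

section \<open>The Seifert graph\<close>

record ('v, 'e) signed_graph =
  nodes :: "'v set"
  edges :: "'e set"
  endpoints :: "'e \<Rightarrow> 'v set"
  plus :: "'e \<Rightarrow> bool"

definition components :: "('v, 'e) signed_graph \<Rightarrow> 'v set set" where
  "components G = classes (nodes G) {(u, v). \<exists>e\<in>edges G. endpoints G e = {u, v}}"

text \<open>Each of the two strands of the oriented smoothing contains exactly one of the incoming arcs.\<close>

definition seifert_graph :: "diagram \<Rightarrow> (nat set, nat) signed_graph" where
  "seifert_graph D =
     \<lparr>nodes = oriented_resolution D,
      edges = {..<n_crossings D},
      endpoints = (\<lambda>k. {C \<in> oriented_resolution D.
                          under_in (crossing_at D k) \<in> C \<or> over_in (crossing_at D k) \<in> C}),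
      plus = (\<lambda>k. positive (crossing_at D k))\<rparr>"

definition seifert_graph_minus :: "diagram \<Rightarrow> (nat set, nat) signed_graph" where
  "seifert_graph_minus D =
     (seifert_graph D)\<lparr>edges := {k \<in> edges (seifert_graph D). \<not> plus (seifert_graph D) k}\<rparr>"

definition seifert_graph_plus :: "diagram \<Rightarrow> (nat set, nat) signed_graph" where
  "seifert_graph_plus D =
     (seifert_graph D)\<lparr>edges := {k \<in> edges (seifert_graph D). plus (seifert_graph D) k}\<rparr>"

definition U_bound :: "diagram \<Rightarrow> int" where
  "U_bound D =
     int (card (nodes (seifert_graph D))) - 2 * int (card (components (seifert_graph_minus D)))
       + writhe D + 1"

definition Delta_defect :: "diagram \<Rightarrow> int" where
  "Delta_defect D =
     int (card (nodes (seifert_graph D))) - int (card (components (seifert_graph_minus D)))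
       - int (card (components (seifert_graph_plus D))) + 1"

end

theory Submission
  imports Defs
begin

text \<open>
  Planarity: the sets of bounded faces have pairwise distinct boundaries mod 2, and counting shows
  that they exhaust the mod-2 cycles of the diagram. Hence every Seifert circle separates its two
  sides, and the two circles at a crossing carry opposite labels in Lee's generator.

  Upper bound: positive crossings only contribute differentials out of the oriented resolution.
  There, the cokernel of the splittings at the negative crossings is a tensor product of copies of
  \<open>\<complex>[y]/(y\<^sup>2 - 1)\<close>, one for each component of \<open>T\<^sup>-\<close>. The image of Lee's generator has a nonzero
  coefficient at the product of all \<open>y\<close>, and every monomial of lower degree misses it.

  Lower bound: reversing the labels on some, but not all, components of \<open>T\<^sup>+\<close> gives a cycle. Some
  negative crossing then joins circles with equal labels, so the cycle is the image of a splitting.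
  The alternating sum over all reversals that fix one component represents the class of Lee's
  generator, and the monomials that survive contain a \<open>1\<close> in every other component.
\<close>

section \<open>Generated equivalence relations\<close>

definition conn :: "'a rel \<Rightarrow> 'a rel" where
  "conn R = (R \<union> R\<inverse>)\<^sup>*"

definition cls :: "'a rel \<Rightarrow> 'a \<Rightarrow> 'a set" where
  "cls R x = conn R `` {x}"

lemma conn_refl [simp]: "(x, x) \<in> conn R"
  by (simp add: conn_def)

lemma conn_sym: "(x, y) \<in> conn R \<Longrightarrow> (y, x) \<in> conn R"
  unfolding conn_def by (metis converse_Un converse_converse converse_iff rtrancl_converseI sup_commute)

lemma conn_trans: "(x, y) \<in> conn R \<Longrightarrow> (y, z) \<in> conn R \<Longrightarrow> (x, z) \<in> conn R"
  unfolding conn_def by (rule rtrancl_trans)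

lemma conn_base: "(x, y) \<in> R \<Longrightarrow> (x, y) \<in> conn R"
  unfolding conn_def by auto

lemma conn_invariant:
  assumes "(x, y) \<in> conn R" and "\<And>u v. (u, v) \<in> R \<Longrightarrow> f u = f v"
  shows "f x = f y"
  using assms(1) unfolding conn_def by induction (use assms(2) in auto)

lemma cls_iff [simp]: "y \<in> cls R x \<longleftrightarrow> (x, y) \<in> conn R"
  by (simp add: cls_def)

lemma cls_eq_iff: "cls R x = cls R y \<longleftrightarrow> (x, y) \<in> conn R"
proof
  assume "cls R x = cls R y"
  then show "(x, y) \<in> conn R" by (metis cls_iff conn_refl)
next
  assume "(x, y) \<in> conn R"
  then have "z \<in> cls R x \<longleftrightarrow> z \<in> cls R y" for z
    unfolding cls_iff by (meson conn_sym conn_trans)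
  then show "cls R x = cls R y" by blast
qed

lemma classes_eq: "classes S R = cls R ` S"
  by (auto simp: classes_def conn_def cls_def quotient_def)

lemma cls_in_classes: "x \<in> S \<Longrightarrow> cls R x \<in> classes S R"
  by (simp add: classes_eq)

lemma classes_cls:
  assumes "C \<in> classes S R" "x \<in> C"
  shows "C = cls R x"
proof -
  obtain z where z: "C = cls R z" using assms(1) by (auto simp: classes_eq)
  with assms(2) have "(z, x) \<in> conn R" by simp
  then show ?thesis unfolding z cls_eq_iff .
qed

lemma classes_nonempty: "C \<in> classes S R \<Longrightarrow> \<exists>x\<in>S. x \<in> C"
  by (auto simp: classes_eq)

lemma classes_subset:
  assumes "R \<subseteq> S \<times> S" "C \<in> classes S R"
  shows "C \<subseteq> S"
proof
  fix y assume "y \<in> C"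
  with assms(2) obtain x where "x \<in> S" "(x, y) \<in> conn R" by (auto simp: classes_eq)
  moreover have "(x \<in> S) = (y \<in> S)"
    by (rule conn_invariant[OF \<open>(x, y) \<in> conn R\<close>]) (use assms(1) in auto)
  ultimately show "y \<in> S" by simp
qed

lemma finite_classes: "finite S \<Longrightarrow> finite (classes S R)"
  by (simp add: classes_eq)

lemma classes_disjoint: "C \<in> classes S R \<Longrightarrow> C' \<in> classes S R \<Longrightarrow> x \<in> C \<Longrightarrow> x \<in> C' \<Longrightarrow> C = C'"
  by (metis classes_cls)

text \<open>Distinct classes are disjoint, so choosing a point of \<open>T\<close> in each of them
  is injective. In the two bounds \<open>T\<close> consists of the circles labelled \<open>X\<close>
  or of those labelled \<open>One\<close>.\<close>

lemma card_classes_le: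
  assumes "finite T" and meets: "\<And>C. C \<in> \<C> \<Longrightarrow> C \<inter> T \<noteq> {}" and "\<C> \<subseteq> classes S R"
  shows "card \<C> \<le> card T"
proof -
  have "\<exists>x. x \<in> C \<inter> T" if "C \<in> \<C>" for C using meets[OF that] by blast
  then obtain g where g: "\<And>C. C \<in> \<C> \<Longrightarrow> g C \<in> C \<inter> T" by metis
  have "inj_on g \<C>"
  proof (rule inj_onI)
    fix C C' assume "C \<in> \<C>" "C' \<in> \<C>" "g C = g C'"
    then show "C = C'" using g[of C] g[of C'] assms(3) classes_disjoint[of C S R C' "g C"] by auto
  qed
  then show ?thesis using assms(1) g by (intro card_inj_on_le[of g]) auto
qed

text \<open>Whether \<open>cls R2 a\<close> and \<open>cls R2 b\<close> coincide is not determined by the hypotheses.\<close>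

lemma reconnect_classes:
  assumes sub: "R \<subseteq> S \<times> S" and S: "a \<in> S" "b \<in> S" "c \<in> S" "d \<in> S"
    and R1: "R1 = R \<union> {(a, b), (c, d)}" and R2: "R2 = R \<union> {(a, c), (d, b)}"
    and sep: "(a, c) \<notin> conn R1"
  shows "classes S R1 - classes S R2 = {cls R1 a, cls R1 c}" (is ?A)
    and "classes S R2 - classes S R1 = {cls R2 a, cls R2 b}" (is ?B)
proof -
  have ab: "(a, b) \<in> conn R1" "(c, d) \<in> conn R1" and ac: "(a, c) \<in> conn R2" "(d, b) \<in> conn R2"
    by (auto intro: conn_base simp: R1 R2)
  \<comment> \<open>A class of \<open>R1\<close> that avoids \<open>a\<close> and \<open>c\<close>
    also avoids \<open>b\<close> and \<open>d\<close>, so paths in it use only \<open>R\<close>,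
    which both relations share.\<close>
  have same: "cls R1 x = cls R2 x"
    if x: "(a, x) \<notin> conn R1" "(c, x) \<notin> conn R1" for x
  proof -
    have "x \<notin> cls R1 a \<union> cls R1 c" using x by auto
    have "(x, y) \<in> conn R2 \<and> (a, y) \<notin> conn R1 \<and> (c, y) \<notin> conn R1" if "(x, y) \<in> conn R1" for y
    proof -
      have n: "(a, y) \<notin> conn R1" "(c, y) \<notin> conn R1"
        using x that conn_trans conn_sym by metis+
      have "(x, y) \<in> (R1 \<union> R1\<inverse>)\<^sup>*" using that by (simp add: conn_def)
      then have "(x, y) \<in> conn R2"
      proof induction
        case (step y z)
        have xy: "(x, y) \<in> conn R1" using step(1) by (simp add: conn_def)
        have ny: "(a, y) \<notin> conn R1" "(c, y) \<notin> conn R1"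
          using x xy conn_trans conn_sym by metis+
        have nz: "(y, z) \<in> conn R1" using step(2) by (auto intro: conn_base conn_sym)
        have "y \<noteq> a" "y \<noteq> b" "y \<noteq> c" "y \<noteq> d" using ny ab by auto
        then have "(y, z) \<in> R \<or> (z, y) \<in> R" using step(2) by (auto simp: R1)
        then have "(y, z) \<in> conn R2" by (auto intro: conn_base conn_sym simp: R2)
        with step(3) show ?case by (rule conn_trans)
      qed simp
      with n show ?thesis by simp
    qed
    moreover have "(x, y) \<in> conn R1" if "(x, y) \<in> conn R2" for y
    proof -
      have "(x, y) \<in> (R2 \<union> R2\<inverse>)\<^sup>*" using that by (simp add: conn_def)
      then show ?thesis
      proof induction
        case (step y z)
        have ny: "(a, y) \<notin> conn R1" "(c, y) \<notin> conn R1"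
          using x step(3) conn_trans conn_sym by metis+
        have "y \<noteq> a" "y \<noteq> b" "y \<noteq> c" "y \<noteq> d" using ny ab by auto
        then have "(y, z) \<in> R \<or> (z, y) \<in> R" using step(2) by (auto simp: R2)
        then have "(y, z) \<in> conn R1" by (auto intro: conn_base conn_sym simp: R1)
        with step(3) show ?case by (rule conn_trans)
      qed simp
    qed
    ultimately show ?thesis by auto
  qed
  have no1: "cls R1 x \<notin> classes S R2" if "x = a \<or> x = c" for x
  proof
    assume "cls R1 x \<in> classes S R2"
    then have "cls R1 x = cls R2 x" by (auto dest: classes_cls[of _ _ _ x])
    then have "(x, a) \<in> conn R1 \<and> (x, c) \<in> conn R1"
      using that ac(1) by (metis cls_iff conn_refl conn_sym)
    then show False using sep conn_sym conn_trans by metis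
  qed
  have no2: "cls R2 x \<notin> classes S R1" if "x = a \<or> x = b" for x
  proof
    assume "cls R2 x \<in> classes S R1"
    then have eq: "cls R2 x = cls R1 x" by (auto dest: classes_cls[of _ _ _ x])
    have "(a, c) \<in> conn R1"
    proof (cases "x = a")
      case True
      with eq ac(1) show ?thesis by (metis cls_iff)
    next
      case False
      with that eq ac(2) have "(b, d) \<in> conn R1" by (metis cls_iff conn_sym)
      then show ?thesis using ab conn_sym conn_trans by metis
    qed
    then show False using sep by simp
  qed
  have in1: "C \<in> {cls R1 a, cls R1 c}" if "C \<in> classes S R1 - classes S R2" for C
  proof -
    obtain x where x: "x \<in> S" "C = cls R1 x" using \<open>C \<in> _\<close> by (auto simp: classes_eq)
    then have "cls R1 x \<noteq> cls R2 x" using \<open>C \<in> _\<close> by (auto simp: classes_eq)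
    then have "(a, x) \<in> conn R1 \<or> (c, x) \<in> conn R1" using same by blast
    then have "C = cls R1 a \<or> C = cls R1 c" unfolding x(2) cls_eq_iff by (meson conn_sym)
    then show ?thesis by simp
  qed
  have in2: "C \<in> {cls R2 a, cls R2 b}" if "C \<in> classes S R2 - classes S R1" for C
  proof -
    obtain x where x: "x \<in> S" "C = cls R2 x" using \<open>C \<in> _\<close> by (auto simp: classes_eq)
    show ?thesis
    proof (cases "{a, b, c, d} \<inter> C = {}")
      case False
      then have "(x, a) \<in> conn R2 \<or> (x, b) \<in> conn R2"
        unfolding x(2) using ac by (simp add: disjoint_iff) (meson conn_trans conn_sym)
      then have "C = cls R2 a \<or> C = cls R2 b" unfolding x(2) cls_eq_iff .
      then show ?thesis by simp
    next
      case True
      have "(x, y) \<in> conn R2" if "(x, y) \<in> conn R1" for y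
      proof -
        have "(x, y) \<in> (R1 \<union> R1\<inverse>)\<^sup>*" using that by (simp add: conn_def)
        then show ?thesis
        proof induction
          case (step y z)
          have "y \<notin> {a, b, c, d}" using True step(3) x by auto
          then have "(y, z) \<in> R \<or> (z, y) \<in> R" using step(2) by (auto simp: R1)
          then have "(y, z) \<in> conn R2" by (auto intro: conn_base conn_sym simp: R2)
          with step(3) show ?case by (rule conn_trans)
        qed simp
      qed
      then have "(a, x) \<notin> conn R1" "(c, x) \<notin> conn R1" using True x conn_sym[of _ x] by auto
      then have "C = cls R1 x" using same x by simp
      then show ?thesis using that x by (auto simp: classes_eq)
    qed
  qed
  show ?A using in1 no1 cls_in_classes[OF S(1), of R1] cls_in_classes[OF S(3), of R1] by auto
  show ?B using in2 no2 cls_in_classes[OF S(1), of R2] cls_in_classes[OF S(2), of R2] by auto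
qed

section \<open>Combinatorics of knot diagrams\<close>

locale knot_code =
  fixes D :: diagram
  assumes knot_diagram: "knot_diagram D"
begin

abbreviation N where "N \<equiv> n_crossings D"
abbreviation ui where "ui k \<equiv> under_in (crossing_at D k)"
abbreviation uo where "uo k \<equiv> under_out (crossing_at D k)"
abbreviation oi where "oi k \<equiv> over_in (crossing_at D k)"
abbreviation oo where "oo k \<equiv> over_out (crossing_at D k)"
abbreviation pos where "pos k \<equiv> positive (crossing_at D k)"
abbreviation neg where "neg \<equiv> negative_crossings D"

lemma arcs_eq: "0 < N \<Longrightarrow> arcs D = {..<2 * N}"
  by (simp add: arcs_def max_def Suc_le_eq)

lemma finite_arcs [simp]: "finite (arcs D)"
  by (simp add: arcs_def)

lemma under_in_inj: "k < N \<Longrightarrow> l < N \<Longrightarrow> ui k = ui l \<Longrightarrow> k = l"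
proof -
  have "distinct (map under_in (crossings D))" using knot_diagram by (simp add: knot_diagram_def)
  then show "k < N \<Longrightarrow> l < N \<Longrightarrow> ui k = ui l \<Longrightarrow> k = l"
    using nth_eq_iff_index_eq[of "map under_in (crossings D)" k l] by simp
qed

lemma over_in_inj: "k < N \<Longrightarrow> l < N \<Longrightarrow> oi k = oi l \<Longrightarrow> k = l"
proof -
  have "distinct (map over_in (crossings D))" using knot_diagram by (simp add: knot_diagram_def)
  then show "k < N \<Longrightarrow> l < N \<Longrightarrow> oi k = oi l \<Longrightarrow> k = l"
    using nth_eq_iff_index_eq[of "map over_in (crossings D)" k l] by simp
qed

lemma under_in_neq_over_in: "k < N \<Longrightarrow> l < N \<Longrightarrow> ui k \<noteq> oi l"
proof
  assume "k < N" "l < N" "ui k = oi l"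
  then have "ui k \<in> under_in ` set (crossings D) \<inter> over_in ` set (crossings D)"
    by (metis IntI image_eqI nth_mem)
  then show False using knot_diagram unfolding knot_diagram_def distinct_append set_map by blast
qed

lemma in_set_range: "under_in ` set (crossings D) \<union> over_in ` set (crossings D) = {..<2 * N}"
  using knot_diagram unfolding knot_diagram_def set_append set_map by blast

lemma in_lt: "k < N \<Longrightarrow> ui k < 2 * N" "k < N \<Longrightarrow> oi k < 2 * N"
  using in_set_range nth_mem[of k "crossings D"] by blast+

lemma out_eq: "k < N \<Longrightarrow> uo k = Suc (ui k) mod (2 * N)" "k < N \<Longrightarrow> oo k = Suc (oi k) mod (2 * N)"
  using knot_diagram nth_mem[of k "crossings D"] by (auto simp: knot_diagram_def)

lemma out_lt:
  assumes "k < N"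
  shows "uo k < 2 * N" "oo k < 2 * N"
proof -
  have "0 < 2 * N" using assms by linarith
  then show "uo k < 2 * N" "oo k < 2 * N" using assms by (simp_all only: out_eq mod_less_divisor)
qed

lemma in_arcs [simp]:
  "k < N \<Longrightarrow> ui k \<in> arcs D" "k < N \<Longrightarrow> oi k \<in> arcs D"
  "k < N \<Longrightarrow> uo k \<in> arcs D" "k < N \<Longrightarrow> oo k \<in> arcs D"
  using in_lt[of k] out_lt[of k] by (auto simp: arcs_def)

lemma arc_cases:
  assumes "e < 2 * N"
  obtains k where "k < N" "e = ui k" | k where "k < N" "e = oi k"
proof -
  from assms in_set_range have "e \<in> under_in ` set (crossings D) \<union> over_in ` set (crossings D)" by simp
  then show ?thesis using that by (auto simp: in_set_conv_nth)
qed

text \<open>Arcs are numbered along the orientation, so arc \<open>e\<close> enters some crossing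
  and \<open>Suc e\<close> leaves it on the same strand. The induction uses that a knot has a single
  component.\<close>

lemma arcs_connected:
  assumes "\<And>k. k < N \<Longrightarrow> f (ui k) = f (uo k)" "\<And>k. k < N \<Longrightarrow> f (oi k) = f (oo k)"
    and "e \<in> arcs D" "e' \<in> arcs D"
  shows "f e = f e'"
proof -
  have "f e = f 0" if "e \<in> arcs D" for e
    using that
  proof (induction e)
    case (Suc e)
    then have lt: "Suc e < 2 * N" by (auto simp: arcs_def split: if_splits)
    then have "e < 2 * N" by simp
    then have "f e = f (Suc e mod (2 * N))"
      by (cases rule: arc_cases) (use assms(1,2) out_eq in auto)
    then show ?case using Suc lt by (auto simp: arcs_def)
  qed simp
  then show ?thesis using assms(3,4) by metis
qed

subsection \<open>Seifert circles\<close>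

definition rel :: "nat set \<Rightarrow> nat rel" where
  "rel V = (\<Union>k<N. smoothing (crossing_at D k) (k \<in> V))"

definition circ :: "nat set \<Rightarrow> nat \<Rightarrow> nat set" where
  "circ V e = cls (rel V) e"

abbreviation seifert_circles where "seifert_circles \<equiv> circles D neg"

lemma circles_eq: "circles D V = classes (arcs D) (rel V)"
  by (simp add: circles_def rel_def)

lemma rel_subset: "rel V \<subseteq> arcs D \<times> arcs D"
  by (auto simp: rel_def smoothing_def)

lemma finite_circles [simp]: "finite (circles D V)"
  by (simp add: circles_eq finite_classes)

lemma circ_in_circles [simp]: "e \<in> arcs D \<Longrightarrow> circ V e \<in> circles D V"
  by (simp add: circ_def circles_eq cls_in_classes)

lemma circles_circ: "C \<in> circles D V \<Longrightarrow> e \<in> C \<Longrightarrow> C = circ V e"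
  unfolding circ_def circles_eq by (rule classes_cls)

lemma self_in_circ [simp]: "e \<in> circ V e"
  by (simp add: circ_def)

lemma circle_subset: "C \<in> circles D V \<Longrightarrow> C \<subseteq> arcs D"
  unfolding circles_eq by (rule classes_subset[OF rel_subset])

lemma circle_nonempty: "C \<in> circles D V \<Longrightarrow> C \<noteq> {}"
  by (auto simp: circles_eq dest: classes_nonempty)

lemma Min_in_circle: "C \<in> circles D V \<Longrightarrow> Min C \<in> C"
  using circle_subset circle_nonempty finite_arcs by (metis Min_in finite_subset)

lemma in_neg_iff: "k < N \<Longrightarrow> k \<in> neg \<longleftrightarrow> \<not> pos k"
  by (simp add: negative_crossings_def)

lemma smoothing_oriented:
  "k < N \<Longrightarrow> (k \<in> V \<longleftrightarrow> \<not> pos k) \<Longrightarrow>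
    smoothing (crossing_at D k) (k \<in> V) = {(ui k, oo k), (oi k, uo k)}"
  by (auto simp: smoothing_def)

lemma smoothing_unoriented:
  "k < N \<Longrightarrow> (k \<in> V \<longleftrightarrow> pos k) \<Longrightarrow>
    smoothing (crossing_at D k) (k \<in> V) = {(ui k, oi k), (uo k, oo k)}"
  by (auto simp: smoothing_def)

lemma rel_neg: "rel neg = (\<Union>k<N. {(ui k, oo k), (oi k, uo k)})"
  unfolding rel_def using smoothing_oriented[of _ neg] in_neg_iff by (intro SUP_cong) auto

lemma circ_strand:
  assumes "k < N" "k \<in> V \<longleftrightarrow> \<not> pos k"
  shows "circ V (oo k) = circ V (ui k)" "circ V (uo k) = circ V (oi k)"
proof -
  have "(ui k, oo k) \<in> rel V" "(oi k, uo k) \<in> rel V"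
    using assms smoothing_oriented[of k V] unfolding rel_def by blast+
  then show "circ V (oo k) = circ V (ui k)" "circ V (uo k) = circ V (oi k)"
    unfolding circ_def cls_eq_iff by (auto intro: conn_base conn_sym)
qed

lemma seifert_strand:
  assumes "k < N"
  shows "circ neg (oo k) = circ neg (ui k)" "circ neg (uo k) = circ neg (oi k)"
  using circ_strand[OF assms] in_neg_iff[OF assms] by auto

subsection \<open>Planarity\<close>

definition corner_rel :: "side rel" where
  "corner_rel = (\<Union>c\<in>set (crossings D). corners c)"

lemma corner_rel_subset: "corner_rel \<subseteq> sides D \<times> sides D"
proof -
  have "corners c \<subseteq> sides D \<times> sides D" if c: "c \<in> set (crossings D)" for c
  proof -
    obtain k where "k < N" "c = crossing_at D k" using c by (metis in_set_conv_nth)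
    then show ?thesis by (auto simp: corners_def sides_def)
  qed
  then show ?thesis unfolding corner_rel_def by blast
qed

lemma faces_eq: "faces D = classes (sides D) corner_rel"
  by (simp add: faces_def corner_rel_def)

lemma card_faces: "card (faces D) = N + 2"
  using knot_diagram by (simp add: knot_diagram_def)

lemma outer_in_sides: "outer D \<in> sides D"
  using knot_diagram by (simp add: knot_diagram_def)

lemma corner_rel_invariant:
  assumes "\<And>u v. (u, v) \<in> corner_rel \<Longrightarrow> f u = f v" "k < N"
  shows "if pos k then f (ui k, True) = f (oi k, False) \<and> f (ui k, False) = f (oo k, False) \<and>
           f (uo k, False) = f (oo k, True) \<and> f (uo k, True) = f (oi k, True)
         else f (ui k, True) = f (oo k, True) \<and> f (ui k, False) = f (oi k, True) \<and>
           f (uo k, False) = f (oi k, False) \<and> f (uo k, True) = f (oo k, False)"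
proof -
  have "corners (crossing_at D k) \<subseteq> corner_rel"
    using nth_mem[OF assms(2)] unfolding corner_rel_def by blast
  then show ?thesis using assms(1) by (auto simp: corners_def)
qed

text \<open>Mod-2 cycles of the underlying 4-valent graph, as sets of arcs.\<close>

definition even_sets :: "nat set set" where
  "even_sets = {E. E \<subseteq> arcs D \<and>
     (\<forall>k<N. (ui k \<in> E \<longleftrightarrow> uo k \<in> E) \<longleftrightarrow> (oi k \<in> E \<longleftrightarrow> oo k \<in> E))}"

definition boundary :: "side set \<Rightarrow> nat set" where
  "boundary K = {e \<in> arcs D. ((e, True) \<in> K) \<noteq> ((e, False) \<in> K)}"

text \<open>An even set changes membership along the lower strand exactly where it does along the
  upper one. Its changes at the \<open>N\<close> crossings and its value at arc \<open>0\<close>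
  therefore determine it along the whole knot.\<close>

lemma card_even_sets: "card even_sets \<le> 2 ^ (N + 1)"
proof -
  \<comment> \<open>The element \<open>N\<close>, which is not the index of a crossing, records
    membership of arc \<open>0\<close>.\<close>
  let ?f = "\<lambda>E. {k. k < N \<and> (ui k \<in> E) \<noteq> (uo k \<in> E)} \<union> (if 0 \<in> E then {N} else {})"
  have "inj_on ?f even_sets"
  proof (rule inj_onI)
    fix E E' assume E: "E \<in> even_sets" "E' \<in> even_sets" and eq: "?f E = ?f E'"
    have k: "(ui k \<in> E) \<noteq> (uo k \<in> E) \<longleftrightarrow> (ui k \<in> E') \<noteq> (uo k \<in> E')" if "k < N" for k
    proof -
      have "k \<in> ?f E \<longleftrightarrow> k \<in> ?f E'" using eq by simp
      then show ?thesis using that by (auto split: if_splits)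
    qed
    have "N \<in> ?f E \<longleftrightarrow> N \<in> ?f E'" using eq by simp
    then have z: "0 \<in> E \<longleftrightarrow> 0 \<in> E'" by (auto split: if_splits)
    have "(e \<in> E \<longleftrightarrow> e \<in> E') = (0 \<in> E \<longleftrightarrow> 0 \<in> E')" if "e \<in> arcs D" for e
    proof (rule arcs_connected[OF _ _ that])
      show "(0::nat) \<in> arcs D" by (auto simp: arcs_def)
      fix k assume "k < N"
      with E k[of k] show "(ui k \<in> E \<longleftrightarrow> ui k \<in> E') = (uo k \<in> E \<longleftrightarrow> uo k \<in> E')"
        "(oi k \<in> E \<longleftrightarrow> oi k \<in> E') = (oo k \<in> E \<longleftrightarrow> oo k \<in> E')"
        by (auto simp: even_sets_def)
    qed
    then show "E = E'" using z E by (auto simp: even_sets_def)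
  qed
  then have "card even_sets \<le> card (Pow {..N})"
    by (rule card_inj_on_le) (auto split: if_splits)
  then show ?thesis by (simp add: card_Pow)
qed

text \<open>A loop around a crossing returns to the face where it started, so it crosses the
  boundary of \<open>K\<close> an even number of times.\<close>

lemma boundary_even:
  assumes "\<And>u v. (u, v) \<in> corner_rel \<Longrightarrow> u \<in> K \<longleftrightarrow> v \<in> K"
  shows "boundary K \<in> even_sets"
proof -
  have "(ui k \<in> boundary K \<longleftrightarrow> uo k \<in> boundary K) \<longleftrightarrow> (oi k \<in> boundary K \<longleftrightarrow> oo k \<in> boundary K)"
    if k: "k < N" for k
  proof -
    note c = corner_rel_invariant[of "\<lambda>u. u \<in> K", OF assms k]
    have "e \<in> boundary K \<longleftrightarrow> ((e, True) \<in> K) \<noteq> ((e, False) \<in> K)" if "e \<in> arcs D" for e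
      using that by (simp add: boundary_def)
    then show ?thesis using c k by (cases "pos k") (simp_all, argo+)
  qed
  then show ?thesis by (auto simp: even_sets_def boundary_def)
qed

text \<open>Corners and flips at a crossing lead from the left of an incoming arc to the left of the
  outgoing one, and a flip reaches the right sides. This expresses that the surface is
  connected.\<close>

lemma corner_flip_invariant_constant:
  assumes "\<And>u v. (u, v) \<in> corner_rel \<Longrightarrow> f u = f v"
    and flip: "\<And>e. e \<in> arcs D \<Longrightarrow> f (e, True) = f (e, False)"
    and "u \<in> sides D" "v \<in> sides D"
  shows "f u = f v"
proof -
  have *: "f (e, True) = f (e', True)" if "e \<in> arcs D" "e' \<in> arcs D" for e e'
  proof (rule arcs_connected[of "\<lambda>e. f (e, True)", OF _ _ that])
    fix k assume k: "k < N"
    note c = corner_rel_invariant[of f, OF assms(1) k]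
    show "f (ui k, True) = f (uo k, True)" "f (oi k, True) = f (oo k, True)"
      using c flip[of "ui k"] flip[of "uo k"] flip[of "oi k"] flip[of "oo k"] k
      by (auto split: if_splits)
  qed
  obtain e s e' s' where uv: "u = (e, s)" "v = (e', s')" by (cases u, cases v)
  then have "e \<in> arcs D" "e' \<in> arcs D" using assms by (auto simp: sides_def)
  then have "f u = f (e, True)" "f v = f (e', True)" using flip uv by (cases s; cases s'; simp)+
  then show ?thesis using *[OF \<open>e \<in> arcs D\<close> \<open>e' \<in> arcs D\<close>] by simp
qed

text \<open>Sphericity: the \<open>2 ^ (N + 1)\<close> sets of bounded faces have distinct boundaries, and there are no
  more mod-2 cycles than that, so every mod-2 cycle bounds.\<close>

lemma even_set_bounds:
  assumes "E \<in> even_sets"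
  obtains K where "outer D \<notin> K" "\<And>u v. (u, v) \<in> corner_rel \<Longrightarrow> u \<in> K \<longleftrightarrow> v \<in> K" "boundary K = E"
proof -
  \<comment> \<open>The unbounded face is left out, since a set of faces and its complement have the
    same boundary. \<open>N + 1\<close> faces remain.\<close>
  let ?F = "cls corner_rel (outer D)"
  let ?P = "Pow (faces D - {?F})"
  have fin: "finite (sides D)" by (simp add: sides_def)
  then have finf: "finite (faces D)" by (simp add: faces_eq finite_classes)
  have F: "?F \<in> faces D" by (simp add: faces_eq cls_in_classes outer_in_sides)
  have out: "outer D \<notin> \<Union>H" if "H \<in> ?P" for H
    using that classes_cls[of _ "sides D" corner_rel "outer D"] by (auto simp: faces_eq)
  have inv: "u \<in> \<Union>H \<longleftrightarrow> v \<in> \<Union>H" if "H \<in> ?P" "(u, v) \<in> corner_rel" for H u v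
  proof -
    have "u \<in> C \<longleftrightarrow> v \<in> C" if "C \<in> faces D" for C
    proof -
      have "(u, v) \<in> conn corner_rel" using \<open>(u, v) \<in> corner_rel\<close> by (rule conn_base)
      then show ?thesis using that by (auto simp: faces_eq classes_eq) (meson conn_trans conn_sym)+
    qed
    then show ?thesis using that(1) by blast
  qed
  have rec: "H = {C \<in> faces D. C \<inter> \<Union>H \<noteq> {}}" if "H \<in> ?P" for H
    using that classes_disjoint[of _ "sides D" corner_rel] classes_nonempty[of _ "sides D" corner_rel]
    unfolding faces_eq by blast
  have "inj_on (\<lambda>H. boundary (\<Union>H)) ?P"
  proof (rule inj_onI)
    fix H H' assume H: "H \<in> ?P" "H' \<in> ?P" and eq: "boundary (\<Union>H) = boundary (\<Union>H')"
    \<comment> \<open>Equal boundaries make agreement of the two sets invariant under corners and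
      flips, and they agree at \<open>outer D\<close>, which neither contains.\<close>
    have "(u \<in> \<Union>H \<longleftrightarrow> u \<in> \<Union>H') = (outer D \<in> \<Union>H \<longleftrightarrow> outer D \<in> \<Union>H')" if "u \<in> sides D" for u
    proof (rule corner_flip_invariant_constant[OF _ _ that outer_in_sides])
      fix u v assume uv: "(u, v) \<in> corner_rel"
      show "(u \<in> \<Union>H \<longleftrightarrow> u \<in> \<Union>H') = (v \<in> \<Union>H \<longleftrightarrow> v \<in> \<Union>H')"
        using inv[OF H(1) uv] inv[OF H(2) uv] by simp
    next
      fix e assume "e \<in> arcs D"
      then have "((e, True) \<in> \<Union>H) \<noteq> ((e, False) \<in> \<Union>H) \<longleftrightarrow>
          ((e, True) \<in> \<Union>H') \<noteq> ((e, False) \<in> \<Union>H')"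
        using eq unfolding boundary_def by blast
      then show "((e, True) \<in> \<Union>H \<longleftrightarrow> (e, True) \<in> \<Union>H') = ((e, False) \<in> \<Union>H \<longleftrightarrow> (e, False) \<in> \<Union>H')"
        by argo
    qed
    then have "u \<in> \<Union>H \<longleftrightarrow> u \<in> \<Union>H'" if "u \<in> sides D" for u using that out[OF H(1)] out[OF H(2)] by simp
    moreover have "\<Union>H \<subseteq> sides D" "\<Union>H' \<subseteq> sides D"
      using H classes_subset[OF corner_rel_subset] unfolding faces_eq by blast+
    ultimately have "\<Union>H = \<Union>H'" by blast
    then show "H = H'" using rec[OF H(1)] rec[OF H(2)] by simp
  qed
  then have "card ((\<lambda>H. boundary (\<Union>H)) ` ?P) = 2 ^ (N + 1)"
    using F finf card_faces by (simp add: card_image card_Pow)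
  moreover have "(\<lambda>H. boundary (\<Union>H)) ` ?P \<subseteq> even_sets"
    by (rule image_subsetI, rule boundary_even, rule inv)
  moreover have "finite even_sets"
    by (rule finite_subset[of _ "Pow (arcs D)"]) (auto simp: even_sets_def)
  ultimately have "(\<lambda>H. boundary (\<Union>H)) ` ?P = even_sets"
    using card_even_sets card_seteq by metis
  then obtain H where "H \<in> ?P" "E = boundary (\<Union>H)" using assms by blast
  then show ?thesis using that[of "\<Union>H"] out[of H] inv[of H] by blast
qed

section \<open>Regions of the oriented resolution and their nesting depth\<close>

lemma seifert_circle_even:
  assumes "C \<in> seifert_circles"
  shows "C \<in> even_sets"
proof -
  have "(ui k \<in> C \<longleftrightarrow> oo k \<in> C) \<and> (oi k \<in> C \<longleftrightarrow> uo k \<in> C)" if "k < N" for k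
    using seifert_strand[OF that] circles_circ[OF assms] self_in_circ by metis
  then show ?thesis using circle_subset[OF assms] by (auto simp: even_sets_def)
qed

definition side_rel :: "nat set \<Rightarrow> side rel" where
  "side_rel C = (\<Union>c\<in>set (crossings D). corners c \<union> joined_corners c) \<union>
     {((e, True), (e, False)) | e. e \<in> arcs D - C}"

lemma same_side_eq: "same_side D C = conn (side_rel C)"
  by (simp add: same_side_def side_rel_def conn_def Let_def)

lemma side_rel_cases:
  assumes "(u, v) \<in> side_rel C"
  obtains "(u, v) \<in> corner_rel"
  | k where "k < N" "pos k" "u = (ui k, True)" "v = (uo k, False)"
  | k where "k < N" "\<not> pos k" "u = (ui k, False)" "v = (uo k, True)"
  | e where "e \<in> arcs D" "e \<notin> C" "u = (e, True)" "v = (e, False)"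
proof -
  consider "(u, v) \<in> corner_rel" | c where "c \<in> set (crossings D)" "(u, v) \<in> joined_corners c"
    | e where "e \<in> arcs D" "e \<notin> C" "u = (e, True)" "v = (e, False)"
    using assms by (auto simp: side_rel_def corner_rel_def)
  then show ?thesis
  proof cases
    case 1
    then show ?thesis using that by blast
  next
    case (2 c)
    then obtain k where k: "k < N" "c = crossing_at D k" by (metis in_set_conv_nth)
    show ?thesis
      using 2(2) k that(2)[OF k(1)] that(3)[OF k(1)] by (auto simp: joined_corners_def split: if_splits)
  next
    case 3
    then show ?thesis using that by blast
  qed
qed

lemma corner_rel_same_side: "(u, v) \<in> corner_rel \<Longrightarrow> (u, v) \<in> same_side D C"
  unfolding same_side_eq by (rule conn_base) (auto simp: side_rel_def corner_rel_def)

lemma joined_same_side: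
  assumes "k < N"
  shows "if pos k then ((ui k, True), (uo k, False)) \<in> same_side D C
    else ((ui k, False), (uo k, True)) \<in> same_side D C"
proof -
  have "joined_corners (crossing_at D k) \<subseteq> side_rel C"
    using nth_mem[OF assms] unfolding side_rel_def by blast
  then show ?thesis by (auto simp: joined_corners_def same_side_eq intro!: conn_base)
qed

lemma flip_same_side: "e \<in> arcs D \<Longrightarrow> e \<notin> C \<Longrightarrow> ((e, True), (e, False)) \<in> same_side D C"
  unfolding same_side_eq by (rule conn_base) (auto simp: side_rel_def)

text \<open>On one side of a strand a single corner follows it through the crossing; on the other
  side the smoothing links two corners. The last claim records that the two strands face the joined
  region with opposite sides.\<close>

lemma strand_sides:
  assumes k: "k < N"
  shows "((ui k, s), (oo k, s)) \<in> same_side D C" "((oi k, s), (uo k, s)) \<in> same_side D C"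
    and "if pos k then ((ui k, True), (oi k, False)) \<in> same_side D C
         else ((ui k, False), (oi k, True)) \<in> same_side D C"
proof -
  define f where "f = cls (side_rel C)"
  have f: "(u, v) \<in> same_side D C \<longleftrightarrow> f u = f v" for u v
    by (simp add: f_def cls_eq_iff same_side_eq)
  have "f u = f v" if "(u, v) \<in> corner_rel" for u v
    using corner_rel_same_side[OF that] f by blast
  note c = corner_rel_invariant[of f, OF this k]
  note j = joined_same_side[OF k, of C, unfolded f]
  show "((ui k, s), (oo k, s)) \<in> same_side D C" "((oi k, s), (uo k, s)) \<in> same_side D C"
    unfolding f using c j by (cases s; auto split: if_splits)+
  show "if pos k then ((ui k, True), (oi k, False)) \<in> same_side D C
         else ((ui k, False), (oi k, True)) \<in> same_side D C"
    unfolding f using c by (auto split: if_splits)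
qed

lemma same_side_along_circle:
  assumes "C \<in> seifert_circles" "e \<in> C" "e' \<in> C"
  shows "((e, s), (e', s)) \<in> same_side D C'"
proof -
  define f where "f e = cls (side_rel C') (e, s)" for e
  have "(e, e') \<in> conn (rel neg)" using circles_circ[OF assms(1,2)] assms(3) by (simp add: circ_def)
  then have "f e = f e'"
    by (rule conn_invariant)
      (use strand_sides(1,2)[of _ s C'] in \<open>auto simp: rel_neg f_def cls_eq_iff same_side_eq\<close>)
  then show ?thesis by (simp add: f_def cls_eq_iff same_side_eq)
qed

text \<open>A form of the Jordan curve theorem. \<open>C\<close> bounds a set \<open>K\<close> of
  sides that \<open>side_rel C\<close> respects, so its two sides are apart; if neither reached
  \<open>outer D\<close>, the surface would be disconnected.\<close>

lemma circle_separates: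
  assumes C: "C \<in> seifert_circles" "e \<in> C"
  shows "((e, True), outer D) \<in> same_side D C \<longleftrightarrow> ((e, False), outer D) \<notin> same_side D C"
proof -
  obtain K where K: "outer D \<notin> K" "\<And>u v. (u, v) \<in> corner_rel \<Longrightarrow> u \<in> K \<longleftrightarrow> v \<in> K" "boundary K = C"
    using even_set_bounds[OF seifert_circle_even[OF C(1)]] by blast
  have bd: "((e, True) \<in> K) \<noteq> ((e, False) \<in> K) \<longleftrightarrow> e \<in> C" if "e \<in> arcs D" for e
    using K(3) that by (auto simp: boundary_def)
  have inv: "(u \<in> K) = (v \<in> K)" if "(u, v) \<in> side_rel C" for u v
    using that
  proof (cases rule: side_rel_cases)
    case 1
    then show ?thesis by (rule K(2))
  next
    case (2 k)
    \<comment> \<open>Either both arcs of the strand lie in \<open>C\<close> or neither does, so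
      crossing them affects membership in \<open>K\<close> alike and the joined corner respects
      \<open>K\<close>.\<close>
    have "ui k \<in> C \<longleftrightarrow> oo k \<in> C"
      using seifert_strand[OF 2(1)] circles_circ[OF C(1)] self_in_circ by metis
    then show ?thesis
      using corner_rel_invariant[of "\<lambda>u. u \<in> K", OF K(2) 2(1)] 2 bd[of "ui k"] bd[of "oo k"]
      by simp argo
  next
    case (3 k)
    have "ui k \<in> C \<longleftrightarrow> oo k \<in> C"
      using seifert_strand[OF 3(1)] circles_circ[OF C(1)] self_in_circ by metis
    then show ?thesis
      using corner_rel_invariant[of "\<lambda>u. u \<in> K", OF K(2) 3(1)] 3 bd[of "ui k"] bd[of "oo k"]
      by simp argo
  next
    case (4 e)
    then show ?thesis using bd by auto
  qed
  have e: "e \<in> arcs D" using circle_subset[OF C(1)] C(2) by blast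
  have "\<not> (((e, True), outer D) \<in> same_side D C \<and> ((e, False), outer D) \<in> same_side D C)"
  proof
    assume "((e, True), outer D) \<in> same_side D C \<and> ((e, False), outer D) \<in> same_side D C"
    then have "((e, True), (e, False)) \<in> conn (side_rel C)"
      unfolding same_side_eq by (blast intro: conn_sym conn_trans)
    then have "((e, True) \<in> K) = ((e, False) \<in> K)" using inv by (rule conn_invariant)
    then show False using bd[OF e] C(2) by simp
  qed
  moreover have "((e, True), outer D) \<in> same_side D C \<or> ((e, False), outer D) \<in> same_side D C"
  proof (rule ccontr)
    assume no: "\<not> ?thesis"
    define f where "f u \<longleftrightarrow> cls (side_rel C) u = cls (side_rel C) (outer D)" for u
    have f: "f u \<longleftrightarrow> (u, outer D) \<in> same_side D C" for u
      by (simp add: f_def cls_eq_iff same_side_eq)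
    have g: "f u = f v" if "(u, v) \<in> same_side D C" for u v
    proof -
      have "cls (side_rel C) u = cls (side_rel C) v"
        using that by (simp add: cls_eq_iff same_side_eq)
      then show ?thesis by (simp add: f_def)
    qed
    have nC: "\<not> f (e', s)" if "e' \<in> C" for e' s
    proof -
      have "f (e', s) = f (e, s)" by (intro g same_side_along_circle[OF C(1) that C(2)])
      then show ?thesis using no f by (cases s) auto
    qed
    have "f (e, True) = f (outer D)"
    proof (rule corner_flip_invariant_constant)
      fix u v assume "(u, v) \<in> corner_rel"
      then show "f u = f v" by (intro g corner_rel_same_side)
    next
      fix e' assume "e' \<in> arcs D"
      then show "f (e', True) = f (e', False)"
        using nC g flip_same_side by (cases "e' \<in> C") auto
    qed (use e outer_in_sides in \<open>auto simp: sides_def\<close>)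
    moreover have "f (outer D)" by (simp add: f_def)
    ultimately show False using no f by simp
  qed
  ultimately show ?thesis by blast
qed

definition depth :: "side \<Rightarrow> nat" where
  "depth u = card {C \<in> seifert_circles. (u, outer D) \<notin> same_side D C}"

text \<open>\<open>nesting_number\<close> counts \<open>C\<close> itself exactly if it is
  counterclockwise, that is, if its left side is cut off from infinity. Hence it is the depth on the
  left of \<open>C\<close>, read off at any arc.\<close>

lemma nesting_number_eq:
  assumes C: "C \<in> seifert_circles" "e \<in> C"
  shows "nesting_number D C = depth (e, True)"
proof -
  have all: "(\<forall>e'\<in>C. ((e', True), outer D) \<notin> same_side D C') \<longleftrightarrow>
      ((e, True), outer D) \<notin> same_side D C'" for C'
    using same_side_along_circle[OF C(1)] C(2) unfolding same_side_eq
    by (meson conn_trans)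
  let ?A = "{C' \<in> seifert_circles. C' \<noteq> C \<and> ((e, True), outer D) \<notin> same_side D C'}"
  have "{C' \<in> seifert_circles. ((e, True), outer D) \<notin> same_side D C'} =
      ?A \<union> (if ((e, True), outer D) \<notin> same_side D C then {C} else {})"
    using C(1) by auto
  moreover have "C \<notin> ?A" by simp
  ultimately have "depth (e, True) =
      card ?A + (if ((e, True), outer D) \<notin> same_side D C then 1 else 0)"
    unfolding depth_def by (simp add: card_insert_if)
  then show ?thesis
    by (simp add: nesting_number_def separates_from_infinity_def counterclockwise_def
        oriented_resolution_def all)
qed

text \<open>Stepping across \<open>e\<close> changes the side only with respect to the Seifert
  circle through \<open>e\<close>, and there it does change.\<close>

lemma depth_flip:
  assumes "e \<in> arcs D"
  shows "even (depth (e, True)) \<longleftrightarrow> odd (depth (e, False))"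
proof -
  let ?C = "circ neg e"
  have C: "?C \<in> seifert_circles" "e \<in> ?C" using assms by auto
  define A where "A = {C \<in> seifert_circles. C \<noteq> ?C \<and> ((e, True), outer D) \<notin> same_side D C}"
  have A: "?C \<notin> A" "finite A" by (auto simp: A_def)
  have other: "((e, True), outer D) \<in> same_side D C' \<longleftrightarrow> ((e, False), outer D) \<in> same_side D C'"
    if "C' \<in> seifert_circles" "C' \<noteq> ?C" for C'
  proof -
    have "e \<notin> C'" using that circles_circ by blast
    from flip_same_side[OF assms this] show ?thesis
      unfolding same_side_eq by (meson conn_sym conn_trans)
  qed
  have s: "{C \<in> seifert_circles. ((e, s), outer D) \<notin> same_side D C} =
      A \<union> (if ((e, s), outer D) \<notin> same_side D ?C then {?C} else {})" for s
    using C(1) other by (cases s) (auto simp: A_def)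
  have "depth (e, s) = card A + (if ((e, s), outer D) \<notin> same_side D ?C then 1 else 0)" for s
    unfolding depth_def s using A by simp
  then show ?thesis using circle_separates[OF C] by auto
qed

text \<open>The label of Lee's generator, as a function of the arcs.\<close>

definition \<delta> :: "nat \<Rightarrow> complex" where
  "\<delta> e = (if even (depth (e, True)) then 1 else - 1)"

lemma depth_same_side:
  assumes "\<And>C. (u, v) \<in> same_side D C"
  shows "depth u = depth v"
proof -
  have "(u, outer D) \<in> same_side D C \<longleftrightarrow> (v, outer D) \<in> same_side D C" for C
    using assms[of C] unfolding same_side_eq by (meson conn_sym conn_trans)
  then show ?thesis by (simp add: depth_def)
qed

lemma delta_strand: "k < N \<Longrightarrow> \<delta> (oo k) = \<delta> (ui k)" "k < N \<Longrightarrow> \<delta> (uo k) = \<delta> (oi k)"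
  using depth_same_side[OF strand_sides(1), of k True] depth_same_side[OF strand_sides(2), of k True]
  by (simp_all add: \<delta>_def)

text \<open>The strands border the joined region with opposite sides, so the depth on the left of
  one is the depth on the right of the other; \<open>depth_flip\<close> then compares left with
  left.\<close>

lemma delta_crossing:
  assumes k: "k < N"
  shows "\<delta> (oi k) = - \<delta> (ui k)"
proof (cases "pos k")
  case True
  then have "depth (ui k, True) = depth (oi k, False)"
    using strand_sides(3)[OF k] by (intro depth_same_side) auto
  then show ?thesis using depth_flip[of "oi k"] k by (simp add: \<delta>_def)
next
  case False
  then have "depth (ui k, False) = depth (oi k, True)"
    using strand_sides(3)[OF k] by (intro depth_same_side) auto
  then show ?thesis using depth_flip[of "ui k"] k by (simp add: \<delta>_def)
qed

end

section \<open>Sign-reversing involutions\<close>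

text \<open>Reindexing by \<open>g\<close> equates the sum with its negative; a fixed point of
  \<open>g\<close> contributes 0.\<close>

lemma sum_involution_zero:
  fixes f :: "'a \<Rightarrow> complex"
  assumes "\<And>x. x \<in> A \<Longrightarrow> g x \<in> A" "\<And>x. x \<in> A \<Longrightarrow> g (g x) = x" "\<And>x. x \<in> A \<Longrightarrow> f (g x) = - f x"
  shows "sum f A = 0"
proof -
  have "sum f A = (\<Sum>x\<in>A. - f x)"
    by (rule sum.reindex_bij_witness[of A g g]) (use assms in auto)
  then show ?thesis by (simp add: sum_negf)
qed

text \<open>Symmetric difference with \<open>{P, Q}\<close>. The case \<open>P = Q\<close>, which
  changes one element, serves for sets of components in the lower bound.\<close>

definition toggle :: "'a \<Rightarrow> 'a \<Rightarrow> 'a set \<Rightarrow> 'a set" where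
  "toggle P Q S = (S - {P, Q}) \<union> ({P, Q} - S)"

lemma toggle_toggle [simp]: "toggle P Q (toggle P Q S) = S"
  by (auto simp: toggle_def)

lemma toggle_iff: "C \<in> toggle P Q S \<longleftrightarrow> (C \<in> S) \<noteq> (C = P \<or> C = Q)"
  by (auto simp: toggle_def)

lemma toggle_split: "S = (S - {P, Q}) \<union> ({P, Q} \<inter> S)" "toggle P Q S = (S - {P, Q}) \<union> ({P, Q} - S)"
  by (auto simp: toggle_def)

lemma even_card_toggle:
  assumes "finite S" "P \<noteq> Q"
  shows "even (card (toggle P Q S)) \<longleftrightarrow> even (card S)"
proof -
  have "card S = card (S - {P, Q}) + card ({P, Q} \<inter> S)"
    by (subst toggle_split(1)[of S P Q], rule card_Un_disjoint) (use assms in auto)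
  moreover have "card (toggle P Q S) = card (S - {P, Q}) + card ({P, Q} - S)"
    unfolding toggle_split(2) by (rule card_Un_disjoint) (use assms in auto)
  moreover have "card ({P, Q} \<inter> S) + card ({P, Q} - S) = 2"
    using card_Int_Diff[of "{P, Q}" S] assms(2) by (simp del: Int_insert_left)
  ultimately show ?thesis by presburger
qed

lemma prod_toggle:
  fixes d :: "'a \<Rightarrow> complex"
  assumes "finite S" "P \<noteq> Q" "d Q = - d P" "\<And>C. d C * d C = 1"
  shows "prod d (toggle P Q S) = - prod d S"
proof -
  let ?x = "prod d ({P, Q} \<inter> S)" and ?y = "prod d ({P, Q} - S)"
  have S: "prod d S = prod d (S - {P, Q}) * ?x"
    by (subst toggle_split(1)[of S P Q], rule prod.union_disjoint) (use assms in auto)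
  have T: "prod d (toggle P Q S) = prod d (S - {P, Q}) * ?y"
    unfolding toggle_split(2) by (rule prod.union_disjoint) (use assms in auto)
  have "?x * ?y = - 1"
    using prod.Int_Diff[of "{P, Q}" d S] assms(2-4) by (simp del: Int_insert_left)
  moreover have "?x * ?x = 1" using assms(4) by (simp flip: prod.distrib)
  ultimately have "?y = - ?x" by (metis mult.assoc mult.left_neutral mult_minus1_right)
  then show ?thesis using S T by simp
qed

lemma subset_insert_eq_iff:
  assumes "M \<notin> I"
  shows "R \<subseteq> insert M I \<and> (\<forall>C\<in>I. C \<in> R \<longleftrightarrow> C \<in> S) \<and> (M \<in> R \<longleftrightarrow> b) \<longleftrightarrow>
    R = (S \<inter> I) \<union> (if b then {M} else {})"
  using assms by (cases b) (simp_all, blast+)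

section \<open>Maps along the edges of the cube\<close>

text \<open>The labels form a group of order two, so the product is \<open>X\<close> for exactly one
  factor \<open>X\<close>. Commutativity makes the order of the two circles irrelevant.\<close>

lemma edge_entry_merge:
  assumes "circles D V - circles D V' = {P, Q}" "circles D V' - circles D V = {M}" "P \<noteq> Q"
  shows "edge_entry D (V, R) (V', S) \<longleftrightarrow>
    (\<forall>C\<in>circles D V \<inter> circles D V'. C \<in> R \<longleftrightarrow> C \<in> S) \<and> (M \<in> S \<longleftrightarrow> (P \<in> R) \<noteq> (Q \<in> R))"
proof -
  have "(\<exists>A B M'. A \<noteq> B \<and> ({P, Q} = {A, B} \<and> {M} = {M'} \<and>
           label_of S M' = label_mult (label_of R A) (label_of R B) \<or>
         {P, Q} = {M'} \<and> {M} = {A, B} \<and> (label_of S A, label_of S B) \<in> label_comult (label_of R M'))) \<longleftrightarrow>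
    label_of S M = label_mult (label_of R P) (label_of R Q)" (is "?L \<longleftrightarrow> ?R")
  proof
    have comm: "label_mult x y = label_mult y x" for x y by (cases x; cases y; simp)
    show "?L \<Longrightarrow> ?R" using assms(3) comm by (auto simp: doubleton_eq_iff)
    show "?R \<Longrightarrow> ?L" using assms(3) by blast
  qed
  also have "?R \<longleftrightarrow> (M \<in> S \<longleftrightarrow> (P \<in> R) \<noteq> (Q \<in> R))"
    by (auto simp: label_of_def)
  finally have *: "?L \<longleftrightarrow> \<dots>" .
  have "label_of R C = label_of S C \<longleftrightarrow> (C \<in> R \<longleftrightarrow> C \<in> S)" for C by (auto simp: label_of_def)
  then show ?thesis by (simp only: edge_entry_def prod.case assms(1,2) *)
qed

text \<open>The coproduct of a label is the sum of all pairs whose product is \<open>X\<close> times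
  that label.\<close>

lemma edge_entry_split:
  assumes "circles D V - circles D V' = {M}" "circles D V' - circles D V = {P, Q}" "P \<noteq> Q"
  shows "edge_entry D (V, R) (V', S) \<longleftrightarrow>
    (\<forall>C\<in>circles D V \<inter> circles D V'. C \<in> R \<longleftrightarrow> C \<in> S) \<and> (M \<in> R \<longleftrightarrow> (P \<in> S \<longleftrightarrow> Q \<in> S))"
proof -
  have "(\<exists>A B M'. A \<noteq> B \<and> ({M} = {A, B} \<and> {P, Q} = {M'} \<and>
           label_of S M' = label_mult (label_of R A) (label_of R B) \<or>
         {M} = {M'} \<and> {P, Q} = {A, B} \<and> (label_of S A, label_of S B) \<in> label_comult (label_of R M'))) \<longleftrightarrow>
    (label_of S P, label_of S Q) \<in> label_comult (label_of R M)" (is "?L \<longleftrightarrow> ?R")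
  proof
    have comm: "(x, y) \<in> label_comult z \<Longrightarrow> (y, x) \<in> label_comult z" for x y z by (cases z) auto
    show "?L \<Longrightarrow> ?R" using assms(3) comm by (auto simp: doubleton_eq_iff)
    show "?R \<Longrightarrow> ?L" using assms(3) by blast
  qed
  also have "?R \<longleftrightarrow> (M \<in> R \<longleftrightarrow> (P \<in> S \<longleftrightarrow> Q \<in> S))"
    by (auto simp: label_of_def)
  finally have *: "?L \<longleftrightarrow> \<dots>" .
  have "label_of R C = label_of S C \<longleftrightarrow> (C \<in> R \<longleftrightarrow> C \<in> S)" for C by (auto simp: label_of_def)
  then show ?thesis by (simp only: edge_entry_def prod.case assms(1,2) *)
qed

text \<open>The case that \<open>reconnect_classes\<close> leaves open, two circles replaced by two:
  it is neither a merge nor a split.\<close>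

lemma edge_entry_two_two:
  assumes "circles D V - circles D V' = {P, Q}" "circles D V' - circles D V = {A, B}" "P \<noteq> Q" "A \<noteq> B"
  shows "\<not> edge_entry D (V, R) (V', S)"
  unfolding edge_entry_def prod.case assms(1,2) using assms(3,4) by (auto simp: doubleton_eq_iff)

text \<open>The coefficient of the state \<open>(V, S)\<close> in the tensor product of the elements \<open>x \<plusminus> 1\<close>, where the
  sign at a circle is the common value of \<open>l\<close> on its arcs.\<close>

definition weight :: "diagram \<Rightarrow> nat set \<Rightarrow> (nat \<Rightarrow> complex) \<Rightarrow> nat set set \<Rightarrow> complex" where
  "weight D V l S = (\<Prod>C\<in>circles D V. if C \<in> S then 1 else l (Min C))"

definition tensor :: "diagram \<Rightarrow> nat set \<Rightarrow> (nat \<Rightarrow> complex) \<Rightarrow> chain" where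
  "tensor D V l = (\<lambda>(W, S). if W = V \<and> S \<subseteq> circles D V then weight D V l S else 0)"

context knot_code begin

text \<open>The signs \<open>p\<close> in the factors \<open>x + p\<close>. They live on arcs rather
  than circles so that one function can label two resolutions at once.\<close>

definition labelling :: "nat set \<Rightarrow> (nat \<Rightarrow> complex) \<Rightarrow> bool" where
  "labelling V l \<longleftrightarrow> (\<forall>e. l e * l e = 1) \<and> (\<forall>(u, v)\<in>rel V. l u = l v)"

lemma labelling_circle:
  assumes "labelling V l" "C \<in> circles D V" "e \<in> C"
  shows "l (Min C) = l e"
proof -
  have "C = circ V e" using circles_circ[OF assms(2,3)] .
  then have "(e, Min C) \<in> conn (rel V)" using Min_in_circle[OF assms(2)] by (simp add: circ_def)
  then have "l e = l (Min C)"
    by (rule conn_invariant) (use assms(1) in \<open>auto simp: labelling_def\<close>)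
  then show ?thesis by simp
qed

lemma labelling_conn: "labelling V l \<Longrightarrow> (u, v) \<in> conn (rel V) \<Longrightarrow> l u = l v"
  by (erule conn_invariant) (auto simp: labelling_def)

lemma labelling_nonzero: "labelling V l \<Longrightarrow> l e \<noteq> 0"
  unfolding labelling_def by (metis mult_zero_left zero_neq_one)

text \<open>In \<open>(x + p) \<otimes> (x - p)\<close>, exchanging the basis elements in both
  factors multiplies the coefficients by \<open>p * (- p) = - 1\<close>.\<close>

lemma weight_toggle:
  assumes l: "labelling V l" and PQ: "P \<in> circles D V" "Q \<in> circles D V" "l (Min Q) = - l (Min P)"
  shows "weight D V l (toggle P Q R) = - weight D V l R"
proof -
  have "P \<noteq> Q"
    using PQ(3) labelling_nonzero[OF l] by (metis add_eq_0_iff mult_2 mult_eq_0_iff zero_neq_numeral)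
  have sq: "l e * l e = 1" for e using l by (simp add: labelling_def)
  have split: "weight D V l S = (if P \<in> S then 1 else l (Min P)) * ((if Q \<in> S then 1 else l (Min Q)) *
      (\<Prod>C\<in>circles D V - {P} - {Q}. if C \<in> S then 1 else l (Min C)))" for S
    unfolding weight_def using PQ \<open>P \<noteq> Q\<close>
    by (subst prod.remove[of _ P], simp, simp, subst prod.remove[of _ Q]) auto
  have rest: "(\<Prod>C\<in>circles D V - {P} - {Q}. if C \<in> toggle P Q R then 1 else l (Min C)) =
      (\<Prod>C\<in>circles D V - {P} - {Q}. if C \<in> R then 1 else l (Min C))"
    by (rule prod.cong) (auto simp: toggle_iff)
  show ?thesis
    unfolding split rest using sq[of "Min P"] PQ(3) by (simp add: toggle_iff flip: mult.assoc)
qed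

section \<open>Changing the smoothing at one crossing\<close>

lemma rel_remove:
  assumes "k < N" "\<And>l. l \<noteq> k \<Longrightarrow> l \<in> V \<longleftrightarrow> l \<in> W"
  shows "rel W = (\<Union>l\<in>{..<N} - {k}. smoothing (crossing_at D l) (l \<in> V)) \<union>
    smoothing (crossing_at D k) (k \<in> W)"
proof -
  have "rel W = (\<Union>l\<in>insert k ({..<N} - {k}). smoothing (crossing_at D l) (l \<in> W))"
    unfolding rel_def using assms(1) by (intro SUP_cong) auto
  also have "\<dots> = (\<Union>l\<in>{..<N} - {k}. smoothing (crossing_at D l) (l \<in> W)) \<union>
      smoothing (crossing_at D k) (k \<in> W)" by blast
  also have "(\<Union>l\<in>{..<N} - {k}. smoothing (crossing_at D l) (l \<in> W)) =
      (\<Union>l\<in>{..<N} - {k}. smoothing (crossing_at D l) (l \<in> V))"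
    using assms(2) by (intro SUP_cong) auto
  finally show ?thesis .
qed

text \<open>The two smoothings pair the same four arcs differently, which is the situation of
  \<open>reconnect_classes\<close>.\<close>

lemma circles_change:
  assumes k: "k < N" and VW: "\<And>l. l \<noteq> k \<Longrightarrow> l \<in> V \<longleftrightarrow> l \<in> W" "k \<in> V \<longleftrightarrow> \<not> pos k" "k \<in> W \<longleftrightarrow> pos k"
    and sep: "(ui k, oi k) \<notin> conn (rel V)"
  shows "circles D V - circles D W = {circ V (ui k), circ V (oi k)}"
    and "circles D W - circles D V = {circ W (ui k), circ W (oo k)}"
proof -
  let ?R = "\<Union>l\<in>{..<N} - {k}. smoothing (crossing_at D l) (l \<in> V)"
  have V: "rel V = ?R \<union> {(ui k, oo k), (oi k, uo k)}"
    using rel_remove[OF k, of V V] smoothing_oriented[OF k VW(2)] by simp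
  have W: "rel W = ?R \<union> {(ui k, oi k), (uo k, oo k)}"
    using rel_remove[OF k VW(1)] smoothing_unoriented[OF k VW(3)] by simp
  have sub: "?R \<subseteq> arcs D \<times> arcs D" using rel_subset[of V] unfolding V by blast
  note r = reconnect_classes[OF sub in_arcs(1)[OF k] in_arcs(4)[OF k] in_arcs(2)[OF k] in_arcs(3)[OF k] V W sep]
  show "circles D V - circles D W = {circ V (ui k), circ V (oi k)}"
    and "circles D W - circles D V = {circ W (ui k), circ W (oo k)}"
    using r by (simp_all add: circles_eq circ_def)
qed

lemma opposite_labels_separate:
  assumes "labelling V l" "l (oi k) = - l (ui k)"
  shows "(ui k, oi k) \<notin> conn (rel V)"
proof
  assume "(ui k, oi k) \<in> conn (rel V)"
  then have "l (ui k) = l (oi k)" using labelling_conn[OF assms(1)] by blast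
  then show False
    using assms(2) labelling_nonzero[OF assms(1)] by (metis add_eq_0_iff mult_2 mult_eq_0_iff zero_neq_numeral)
qed

text \<open>This is \<open>(x + 1) * (x - 1) = 0\<close>: reversing the labels of both circles keeps
  the label of their product and negates the weight. If two circles turn into two, there are no
  entries to sum.\<close>

lemma merge_opposite_labels:
  assumes l: "labelling V l" and k: "k < N" "k \<notin> V" "pos k" "l (oi k) = - l (ui k)"
  shows "(\<Sum>R | R \<subseteq> circles D V \<and> edge_entry D (V, R) (insert k V, S). weight D V l R) = 0"
proof -
  let ?W = "insert k V" and ?P = "circ V (ui k)" and ?Q = "circ V (oi k)"
  have sep: "(ui k, oi k) \<notin> conn (rel V)" using opposite_labels_separate[OF l k(4)] .
  have c: "circles D V - circles D ?W = {?P, ?Q}"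
    "circles D ?W - circles D V = {circ ?W (ui k), circ ?W (oo k)}"
    using circles_change[OF k(1) _ _ _ sep, of ?W] k by auto
  have PQ: "?P \<in> circles D V" "?Q \<in> circles D V" "?P \<noteq> ?Q"
    using k sep by simp_all (simp add: circ_def cls_eq_iff)
  show ?thesis
  proof (cases "circ ?W (ui k) = circ ?W (oo k)")
    case False
    show ?thesis using edge_entry_two_two[OF c PQ(3) False] by simp
  next
    case True
    with c(2) have c2: "circles D ?W - circles D V = {circ ?W (ui k)}" by simp
    have "l (Min ?P) = l (ui k)" "l (Min ?Q) = l (oi k)"
      using labelling_circle[OF l] PQ by auto
    then have PQl: "l (Min ?Q) = - l (Min ?P)" using k(4) by simp
    show ?thesis
    proof (rule sum_involution_zero[where g = "toggle ?P ?Q"])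
      fix R assume R: "R \<in> {R. R \<subseteq> circles D V \<and> edge_entry D (V, R) (?W, S)}"
      have "?P \<notin> circles D ?W" "?Q \<notin> circles D ?W" using c(1) by blast+
      then show "toggle ?P ?Q R \<in> {R. R \<subseteq> circles D V \<and> edge_entry D (V, R) (?W, S)}"
        using R PQ unfolding edge_entry_merge[OF c(1) c2 PQ(3)] by (auto simp: toggle_iff)
      show "weight D V l (toggle ?P ?Q R) = - weight D V l R"
        by (rule weight_toggle[OF l PQ(1,2) PQl])
    qed simp
  qed
qed

lemma out_inj:
  assumes "k < N" "l < N"
  shows "oo k = oo l \<Longrightarrow> k = l" "uo k = uo l \<Longrightarrow> k = l" "uo k \<noteq> oo l"
proof -
  have inj: "a = b" if "Suc a mod (2 * N) = Suc b mod (2 * N)" "a < 2 * N" "b < 2 * N" for a b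
    using that by (auto simp: mod_Suc split: if_splits)
  show "oo k = oo l \<Longrightarrow> k = l" using inj[of "oi k" "oi l"] in_lt over_in_inj out_eq assms by metis
  show "uo k = uo l \<Longrightarrow> k = l" using inj[of "ui k" "ui l"] in_lt under_in_inj out_eq assms by metis
  show "uo k \<noteq> oo l" using inj[of "ui k" "oi l"] in_lt under_in_neq_over_in out_eq assms by metis
qed

text \<open>Following a Seifert circle from the end of a strand leads back to its start through the other
  strands: a finite set that is closed under an injective successor map is closed under predecessors.\<close>

lemma strand_bypass:
  assumes k: "k < N" and sep: "(ui k, oi k) \<notin> conn (rel neg)"
  shows "(ui k, oo k) \<in> conn (\<Union>l\<in>{..<N} - {k}. {(ui l, oo l), (oi l, uo l)})"
proof -
  define E where "E = (\<Union>l\<in>{..<N} - {k}. {(ui l, oo l), (oi l, uo l)})"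
  define B where "B = {y \<in> arcs D. (oo k, y) \<in> E\<^sup>*}"
  have EN: "E\<^sup>* \<subseteq> conn (rel neg)"
  proof -
    have "E \<subseteq> rel neg \<union> (rel neg)\<inverse>" unfolding rel_neg E_def by blast
    then show ?thesis unfolding conn_def by (rule rtrancl_mono)
  qed
  have "ui k \<in> B"
  proof (rule ccontr)
    assume ui: "ui k \<notin> B"
    have oi: "oi k \<notin> B"
    proof
      assume "oi k \<in> B"
      then have "(oo k, oi k) \<in> conn (rel neg)" using EN by (auto simp: B_def)
      moreover have "(ui k, oo k) \<in> conn (rel neg)" using k by (intro conn_base) (auto simp: rel_neg)
      ultimately show False using sep conn_trans by metis
    qed
    \<comment> \<open>Only \<open>ui k\<close> and \<open>oi k\<close> have no successor in
      \<open>E\<close>, and \<open>B\<close> contains neither: the first by assumption, the second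
      because it lies on another circle.\<close>
    have "\<exists>z\<in>B. (y, z) \<in> E" if y: "y \<in> B" for y
    proof -
      have "0 < N" using k by linarith
      then have "y < 2 * N" using y by (simp add: B_def arcs_eq)
      then obtain z where "z \<in> arcs D" "(y, z) \<in> E"
      proof (cases rule: arc_cases)
        case (1 l)
        then show ?thesis using that[of "oo l"] ui y by (auto simp: E_def)
      next
        case (2 l)
        then show ?thesis using that[of "uo l"] oi y by (auto simp: E_def)
      qed
      then show ?thesis using y by (auto simp: B_def intro: rtrancl_into_rtrancl)
    qed
    then obtain g where g: "\<And>y. y \<in> B \<Longrightarrow> g y \<in> B" "\<And>y. y \<in> B \<Longrightarrow> (y, g y) \<in> E" by metis
    have pre: "y = y'" if "(y, z) \<in> E" "(y', z) \<in> E" for y y' z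
      using that out_inj unfolding E_def by (auto; metis)
    have "inj_on g B" using g(2) pre by (metis inj_onI)
    moreover have "finite B" by (simp add: B_def)
    ultimately have "g ` B = B" using g(1) by (intro endo_inj_surj) auto
    moreover have "oo k \<in> B" using k by (simp add: B_def)
    \<comment> \<open>As \<open>g\<close> permutes \<open>B\<close>, the arc \<open>oo k\<close> has
      a predecessor, although the only strand that ends there was removed.\<close>
    ultimately obtain y where "y \<in> B" "g y = oo k" by (metis imageE)
    then have "(y, oo k) \<in> E" using g(2) by metis
    then show False using out_inj k unfolding E_def by (auto; metis)
  qed
  then have "(oo k, ui k) \<in> conn E"
    unfolding B_def conn_def using rtrancl_mono[of E "E \<union> E\<inverse>"] by blast
  then show ?thesis unfolding E_def by (rule conn_sym)
qed

lemma labelling_delta: "labelling neg \<delta>"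
  unfolding labelling_def rel_neg using delta_strand by (auto simp: \<delta>_def)

lemma seifert_separate: "k < N \<Longrightarrow> (ui k, oi k) \<notin> conn (rel neg)"
  by (rule opposite_labels_separate[OF labelling_delta delta_crossing])

text \<open>\<open>strand_bypass\<close> settles the coincidence left open in
  \<open>circles_change\<close>: undoing the 1-smoothing at a negative crossing merges its two
  Seifert circles, so the edge into \<open>neg\<close> is a splitting.\<close>

lemma circles_split:
  assumes k: "k \<in> neg"
  shows "circles D (neg - {k}) - seifert_circles = {circ (neg - {k}) (ui k)}"
    and "seifert_circles - circles D (neg - {k}) = {circ neg (ui k), circ neg (oi k)}"
    and "circ neg (ui k) \<noteq> circ neg (oi k)"
proof -
  have kN: "k < N" "\<not> pos k" using k by (auto simp: negative_crossings_def)
  note sep = seifert_separate[OF kN(1)]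
  let ?V = "neg - {k}"
  let ?E = "\<Union>l\<in>{..<N} - {k}. {(ui l, oo l), (oi l, uo l)}"
  have "?E = (\<Union>l\<in>{..<N} - {k}. smoothing (crossing_at D l) (l \<in> neg))"
    using smoothing_oriented[of _ neg] in_neg_iff by (intro SUP_cong) auto
  then have "?E \<subseteq> rel ?V" using rel_remove[OF kN(1), of neg ?V] by auto
  then have "conn ?E \<subseteq> conn (rel ?V)" unfolding conn_def by (intro rtrancl_mono) auto
  then have "circ ?V (ui k) = circ ?V (oo k)"
    using strand_bypass[OF kN(1) sep] by (auto simp: circ_def cls_eq_iff)
  moreover have "seifert_circles - circles D ?V = {circ neg (ui k), circ neg (oi k)}"
    "circles D ?V - seifert_circles = {circ ?V (ui k), circ ?V (oo k)}"
    using circles_change[OF kN(1) _ _ _ sep, of ?V] k kN by auto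
  ultimately show "circles D ?V - seifert_circles = {circ ?V (ui k)}"
    and "seifert_circles - circles D ?V = {circ neg (ui k), circ neg (oi k)}" by auto
  show "circ neg (ui k) \<noteq> circ neg (oi k)" using sep by (simp add: circ_def cls_eq_iff)
qed

text \<open>For \<open>p * p = 1\<close> the coproduct sends \<open>x + p\<close> to
  \<open>(x + p) \<otimes> (x + p)\<close>.\<close>

lemma split_equal_labels:
  assumes k: "k \<in> neg" and l: "labelling neg l" "labelling (neg - {k}) l" and S: "S \<subseteq> seifert_circles"
  shows "(\<Sum>R | R \<subseteq> circles D (neg - {k}) \<and> edge_entry D (neg - {k}, R) (neg, S).
    weight D (neg - {k}) l R) = weight D neg l S"
proof -
  let ?V = "neg - {k}"
  have kN: "k < N" "\<not> pos k" using k by (auto simp: negative_crossings_def)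
  let ?P = "circ neg (ui k)" and ?Q = "circ neg (oi k)" and ?M = "circ ?V (ui k)"
  define I where "I = circles D ?V \<inter> seifert_circles"
  note c = circles_split[OF k]
  have "k \<in> ?V \<longleftrightarrow> pos k" using kN by simp
  from smoothing_unoriented[OF kN(1) this] have "(ui k, oi k) \<in> rel ?V"
    using kN(1) unfolding rel_def by blast
  then have "l (oi k) = l (ui k)" using l(2) by (auto simp: labelling_def)
  moreover have "l (Min ?P) = l (ui k)" "l (Min ?Q) = l (oi k)" "l (Min ?M) = l (ui k)"
    using labelling_circle[OF l(1)] labelling_circle[OF l(2)] kN(1) by auto
  ultimately have lab: "l (Min ?Q) = l (Min ?P)" "l (Min ?M) = l (Min ?P)" by simp_all
  have sq: "l (Min ?P) * l (Min ?P) = 1" using l(1) by (simp add: labelling_def)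
  have I: "finite I" "?P \<notin> I" "?Q \<notin> I" "?M \<notin> I" using c by (auto simp: I_def)
  have V: "circles D ?V = insert ?M I" and O: "seifert_circles = insert ?P (insert ?Q I)"
    using c(1,2) unfolding I_def by blast+
  define R where "R = (S \<inter> I) \<union> (if ?P \<in> S \<longleftrightarrow> ?Q \<in> S then {?M} else {})"
  have "R' \<subseteq> circles D ?V \<and> edge_entry D (?V, R') (neg, S) \<longleftrightarrow> R' = R" for R'
    unfolding edge_entry_split[OF c] I_def[symmetric] R_def
    using subset_insert_eq_iff[OF I(4)] by (simp only: V)
  then have "{R. R \<subseteq> circles D ?V \<and> edge_entry D (?V, R) (neg, S)} = {R}" by simp
  then have "(\<Sum>R | R \<subseteq> circles D ?V \<and> edge_entry D (?V, R) (neg, S). weight D ?V l R) = weight D ?V l R"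
    by simp
  also have "\<dots> = (if ?M \<in> R then 1 else l (Min ?M)) * (\<Prod>C\<in>I. if C \<in> R then 1 else l (Min C))"
    unfolding weight_def V using I by simp
  also have "(\<Prod>C\<in>I. if C \<in> R then 1 else l (Min C)) = (\<Prod>C\<in>I. if C \<in> S then 1 else l (Min C))"
    by (rule prod.cong) (use I in \<open>auto simp: R_def\<close>)
  also have "(if ?M \<in> R then 1 else l (Min ?M)) =
      (if ?P \<in> S then 1 else l (Min ?P)) * (if ?Q \<in> S then 1 else l (Min ?Q))"
    using I lab sq by (auto simp: R_def)
  also have "\<dots> * (\<Prod>C\<in>I. if C \<in> S then 1 else l (Min C)) = weight D neg l S"
    unfolding weight_def O using I c(3) by (simp add: mult.assoc)
  finally show ?thesis .
qed

section \<open>Tensors that are cycles or boundaries\<close>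

lemma differential_tensor:
  assumes "(W, S) \<in> states D"
  shows "differential D (tensor D V l) (W, S) =
    (\<Sum>k\<in>W. if W - {k} = V then (- 1) ^ card {j \<in> W. j < k} *
      (\<Sum>R | R \<subseteq> circles D V \<and> edge_entry D (V, R) (W, S). weight D V l R) else 0)"
proof -
  have "(\<Sum>R | R \<subseteq> circles D (W - {k}) \<and> edge_entry D (W - {k}, R) (W, S). tensor D V l (W - {k}, R)) =
    (if W - {k} = V then \<Sum>R | R \<subseteq> circles D V \<and> edge_entry D (V, R) (W, S). weight D V l R else 0)" for k
    by (auto simp: tensor_def intro: sum.cong)
  then show ?thesis using assms by (auto simp: differential_def intro!: sum.cong)
qed

text \<open>Every edge leaving \<open>neg\<close> 1-smooths a positive crossing, where the labels
  are opposite and the map vanishes.\<close>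

lemma tensor_cycle:
  assumes l: "labelling neg l" and opp: "\<And>k. k < N \<Longrightarrow> pos k \<Longrightarrow> l (oi k) = - l (ui k)"
  shows "differential D (tensor D neg l) = (\<lambda>_. 0)"
proof
  fix \<sigma> :: state
  obtain W S where \<sigma>: "\<sigma> = (W, S)" by (cases \<sigma>)
  show "differential D (tensor D neg l) \<sigma> = 0"
  proof (cases "(W, S) \<in> states D")
    case True
    have "(\<Sum>R | R \<subseteq> seifert_circles \<and> edge_entry D (neg, R) (W, S). weight D neg l R) = 0"
      if "k \<in> W" "W - {k} = neg" for k
    proof -
      have k: "k < N" "k \<notin> neg" using True that by (auto simp: states_def)
      then have "pos k" using in_neg_iff by blast
      moreover have "W = insert k neg" using that by blast
      ultimately show ?thesis using merge_opposite_labels[OF l k _ opp] k by simp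
    qed
    then show ?thesis unfolding \<sigma> differential_tensor[OF True] by (intro sum.neutral) simp
  qed (simp add: \<sigma> differential_def)
qed

text \<open>Equal labels at \<open>k\<close> make \<open>l\<close> a labelling of
  \<open>neg - {k}\<close> as well. The differential of that tensor is, up to sign,
  \<open>tensor D neg l\<close> at \<open>neg\<close>; all other edges belong to positive crossings
  and contribute 0.\<close>

lemma tensor_boundary:
  assumes l: "labelling neg l" and opp: "\<And>k. k < N \<Longrightarrow> pos k \<Longrightarrow> l (oi k) = - l (ui k)"
    and k: "k \<in> neg" "l (oi k) = l (ui k)"
  shows "tensor D neg l \<in> boundaries D 0"
proof -
  let ?V = "neg - {k}"
  \<comment> \<open>The sign of the edge into \<open>neg\<close>; its square is 1, so scaling the
    preimage by it removes it.\<close>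
  define c :: complex where "c = (- 1) ^ card {j \<in> neg. j < k}"
  have c: "c * c = 1" by (simp add: c_def flip: power_add)
  have kN: "k < N" "\<not> pos k" using k by (auto simp: negative_crossings_def)
  have lV: "labelling ?V l"
  proof -
    have "l u = l v" if "(u, v) \<in> rel ?V" for u v
    proof -
      have "k \<in> ?V \<longleftrightarrow> pos k" using kN by simp
      from smoothing_unoriented[OF kN(1) this] have "(u, v) \<in> rel neg \<or> (u, v) \<in> {(ui k, oi k), (uo k, oo k)}"
        using that rel_remove[OF kN(1), of neg ?V] rel_remove[OF kN(1), of neg neg] by auto
      moreover have "l (uo k) = l (oi k)" "l (oo k) = l (ui k)"
        using l kN(1) by (auto simp: labelling_def rel_neg)
      ultimately show ?thesis using k(2) l by (auto simp: labelling_def)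
    qed
    then show ?thesis using l by (auto simp: labelling_def)
  qed
  let ?g = "\<lambda>\<sigma>. c * tensor D ?V l \<sigma>"
  have scale: "differential D ?g \<sigma> = c * differential D (tensor D ?V l) \<sigma>" for \<sigma>
    by (cases \<sigma>) (simp add: differential_def sum_distrib_left mult.left_commute)
  have "differential D ?g = tensor D neg l"
  proof
    fix \<sigma> :: state
    obtain W S where \<sigma>: "\<sigma> = (W, S)" by (cases \<sigma>)
    consider "(W, S) \<notin> states D" | "(W, S) \<in> states D" "W = neg" | "(W, S) \<in> states D" "W \<noteq> neg" by blast
    then have "c * differential D (tensor D ?V l) (W, S) = tensor D neg l (W, S)"
    proof cases
      case 1
      then show ?thesis by (auto simp: differential_def tensor_def states_def negative_crossings_def)
    next
      case 2
      then have S: "S \<subseteq> seifert_circles" by (simp add: states_def)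
      have eq: "neg - {j} = ?V \<longleftrightarrow> j = k" if "j \<in> neg" for j using that k by blast
      have st: "(neg, S) \<in> states D" using 2 by simp
      from S have "differential D (tensor D ?V l) (W, S) = (\<Sum>j\<in>neg. if j = k then c * weight D neg l S else 0)"
        unfolding 2(2) differential_tensor[OF st]
        using split_equal_labels[OF k(1) l lV S] eq by (intro sum.cong) (auto simp: c_def)
      also have "\<dots> = c * weight D neg l S" using k by (simp add: negative_crossings_def)
      finally show ?thesis using c S 2 by (simp add: tensor_def flip: mult.assoc)
    next
      case 3
      have "(\<Sum>R | R \<subseteq> circles D ?V \<and> edge_entry D (?V, R) (W, S). weight D ?V l R) = 0"
        if j: "j \<in> W" "W - {j} = ?V" for j
      proof -
        have "j \<noteq> k" using 3(2) j k by blast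
        then have "j < N" "j \<notin> ?V" "j \<notin> neg" using 3(1) j by (auto simp: states_def)
        moreover from this have "pos j" using in_neg_iff by blast
        moreover have "W = insert j ?V" using j by blast
        ultimately show ?thesis using merge_opposite_labels[OF lV, of j S] opp[of j] by simp
      qed
      then have "differential D (tensor D ?V l) (W, S) = 0"
        unfolding differential_tensor[OF 3(1)] by (intro sum.neutral) simp
      then show ?thesis using 3 by (simp add: tensor_def)
    qed
    then show "differential D ?g \<sigma> = tensor D neg l \<sigma>" unfolding scale \<sigma> .
  qed
  moreover have "?g \<in> chains D (0 - 1)"
  proof -
    have fin: "finite neg" by (simp add: negative_crossings_def)
    then have "int (card ?V) = int (card neg) - 1" using card_Suc_Diff1[OF fin k(1)] by linarith
    then show ?thesis
      by (auto simp: chains_def tensor_def states_def negative_crossings_def split: if_splits)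
  qed
  ultimately show ?thesis unfolding boundaries_def by (metis imageI)
qed

end

section \<open>Linear algebra of the complex\<close>

lemma differential_add_scale:
  "differential D (\<lambda>\<sigma>. c * f \<sigma> + g \<sigma>) = (\<lambda>\<sigma>. c * differential D f \<sigma> + differential D g \<sigma>)"
  by (auto simp: differential_def fun_eq_iff sum.distrib sum_distrib_left algebra_simps)

lemma differential_linear:
  "finite A \<Longrightarrow> differential D (\<lambda>\<sigma>. \<Sum>x\<in>A. c x * f x \<sigma>) = (\<lambda>\<sigma>. \<Sum>x\<in>A. c x * differential D (f x) \<sigma>)"
proof (induction A rule: finite_induct)
  case empty
  show ?case by (auto simp: differential_def fun_eq_iff)
next
  case (insert x A)
  then show ?case using differential_add_scale[of D "c x" "f x"] by simp
qed

lemma chains_linear: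
  assumes "\<And>x. x \<in> A \<Longrightarrow> f x \<in> chains D i"
  shows "(\<lambda>\<sigma>. \<Sum>x\<in>A. c x * f x \<sigma>) \<in> chains D i"
  unfolding chains_def mem_Collect_eq
proof (intro allI impI)
  fix \<sigma> assume "(\<Sum>x\<in>A. c x * f x \<sigma>) \<noteq> 0"
  then obtain x where "x \<in> A" "c x * f x \<sigma> \<noteq> 0" by (rule sum.not_neutral_contains_not_neutral)
  then have "f x \<in> chains D i" "f x \<sigma> \<noteq> 0" using assms by auto
  then show "\<sigma> \<in> states D \<and> hdeg D \<sigma> = i" unfolding chains_def by blast
qed

lemma boundaries_linear:
  assumes "finite A" "\<And>x. x \<in> A \<Longrightarrow> f x \<in> boundaries D i"
  shows "(\<lambda>\<sigma>. \<Sum>x\<in>A. c x * f x \<sigma>) \<in> boundaries D i"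
proof -
  have "\<exists>g. g \<in> chains D (i - 1) \<and> f x = differential D g" if "x \<in> A" for x
    using assms(2)[OF that] by (auto simp: boundaries_def)
  then obtain g where g: "\<And>x. x \<in> A \<Longrightarrow> g x \<in> chains D (i - 1) \<and> f x = differential D (g x)" by metis
  have "(\<lambda>\<sigma>. \<Sum>x\<in>A. c x * f x \<sigma>) = differential D (\<lambda>\<sigma>. \<Sum>x\<in>A. c x * g x \<sigma>)"
    unfolding differential_linear[OF assms(1)] using g by (auto intro: sum.cong)
  then show ?thesis unfolding boundaries_def using chains_linear[of A g] g by blast
qed

lemma homology_class_iff: "y \<in> homology_class D i z \<longleftrightarrow> (\<lambda>\<sigma>. y \<sigma> - z \<sigma>) \<in> boundaries D i"
proof
  assume "(\<lambda>\<sigma>. y \<sigma> - z \<sigma>) \<in> boundaries D i"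
  moreover have "y = (\<lambda>\<sigma>. z \<sigma> + (y \<sigma> - z \<sigma>))" by simp
  ultimately show "y \<in> homology_class D i z"
    unfolding homology_class_def by (intro CollectI exI[of _ "\<lambda>\<sigma>. y \<sigma> - z \<sigma>"] conjI)
qed (auto simp: homology_class_def)

lemma homology_class_eq:
  assumes b: "b \<in> boundaries D i"
  shows "homology_class D i (\<lambda>\<sigma>. z \<sigma> + b \<sigma>) = homology_class D i z"
proof -
  have lin: "(\<lambda>\<sigma>. f \<sigma> + c * b \<sigma>) \<in> boundaries D i" if "f \<in> boundaries D i" for f c
    using boundaries_linear[of "{True, False}" "\<lambda>x. if x then f else b" D i "\<lambda>x. if x then 1 else c"]
      that b by simp
  show ?thesis
    unfolding set_eq_iff homology_class_iff
  proof (intro allI iffI)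
    fix y assume "(\<lambda>\<sigma>. y \<sigma> - (z \<sigma> + b \<sigma>)) \<in> boundaries D i"
    from lin[OF this, of 1] show "(\<lambda>\<sigma>. y \<sigma> - z \<sigma>) \<in> boundaries D i" by simp
  next
    fix y assume "(\<lambda>\<sigma>. y \<sigma> - z \<sigma>) \<in> boundaries D i"
    from lin[OF this, of "- 1"] show "(\<lambda>\<sigma>. y \<sigma> - (z \<sigma> + b \<sigma>)) \<in> boundaries D i"
      by (simp add: diff_diff_eq)
  qed
qed

lemma in_homology_class: "z \<in> homology_class D i z"
  \<comment> \<open>The empty combination: the zero chain is a boundary.\<close>
  using boundaries_linear[of "{}" "\<lambda>_. undefined" D i] by (simp add: homology_class_iff)

context knot_code begin

section \<open>Lee's generator and the Seifert graph\<close>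

lemma finite_neg [simp]: "finite neg"
  by (simp add: negative_crossings_def)

lemma canonical_generator_eq: "canonical_generator D = tensor D neg \<delta>"
proof -
  have "(if C \<in> S \<or> even (nesting_number D C) then 1 else - 1) = (if C \<in> S then 1 else \<delta> (Min C))"
    if "C \<in> seifert_circles" for C S
    using nesting_number_eq[OF that Min_in_circle[OF that]] by (simp add: \<delta>_def)
  then show ?thesis
    by (auto simp: canonical_generator_def tensor_def weight_def oriented_resolution_def fun_eq_iff
        intro!: prod.cong)
qed

lemma tensor_chain: "tensor D neg l \<in> chains D 0"
  by (auto simp: chains_def tensor_def states_def negative_crossings_def split: if_splits)

definition graph_rel :: "bool \<Rightarrow> nat set rel" where
  "graph_rel s = {(u, v). \<exists>k<N. pos k = s \<and> {circ neg (ui k), circ neg (oi k)} = {u, v}}"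

definition comps :: "bool \<Rightarrow> nat set set set" where
  "comps s = classes seifert_circles (graph_rel s)"

lemma graph_rel_subset: "graph_rel s \<subseteq> seifert_circles \<times> seifert_circles"
  by (auto simp: graph_rel_def doubleton_eq_iff)

lemma endpoints_seifert_graph:
  assumes "k < N"
  shows "endpoints (seifert_graph D) k = {circ neg (ui k), circ neg (oi k)}"
proof -
  have "{C \<in> seifert_circles. ui k \<in> C \<or> oi k \<in> C} = {circ neg (ui k), circ neg (oi k)}"
    using circles_circ[of _ neg] assms by auto
  then show ?thesis by (simp add: seifert_graph_def oriented_resolution_def)
qed

lemma components_eq:
  "components (seifert_graph_minus D) = comps False" "components (seifert_graph_plus D) = comps True"
proof -
  have "{(u, v). \<exists>k\<in>edges (seifert_graph_minus D). endpoints (seifert_graph_minus D) k = {u, v}} =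
      graph_rel False"
    unfolding graph_rel_def seifert_graph_minus_def using endpoints_seifert_graph
    by (auto simp: seifert_graph_def)
  then show "components (seifert_graph_minus D) = comps False"
    by (simp add: components_def comps_def seifert_graph_minus_def seifert_graph_def oriented_resolution_def)
  have "{(u, v). \<exists>k\<in>edges (seifert_graph_plus D). endpoints (seifert_graph_plus D) k = {u, v}} =
      graph_rel True"
    unfolding graph_rel_def seifert_graph_plus_def using endpoints_seifert_graph
    by (auto simp: seifert_graph_def)
  then show "components (seifert_graph_plus D) = comps True"
    by (simp add: components_def comps_def seifert_graph_plus_def seifert_graph_def oriented_resolution_def)
qed

lemma nodes_eq: "nodes (seifert_graph D) = seifert_circles"
  by (simp add: seifert_graph_def oriented_resolution_def)

lemma comps_crossing:
  assumes "k < N" "K \<in> comps (pos k)"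
  shows "circ neg (ui k) \<in> K \<longleftrightarrow> circ neg (oi k) \<in> K"
proof -
  have c: "(circ neg (ui k), circ neg (oi k)) \<in> conn (graph_rel (pos k))"
    using assms(1) by (intro conn_base) (auto simp: graph_rel_def)
  obtain C where K: "K = cls (graph_rel (pos k)) C" using assms(2) by (auto simp: comps_def classes_eq)
  show ?thesis unfolding K cls_iff using c by (meson conn_sym conn_trans)
qed

lemma comps_subset: "K \<in> comps s \<Longrightarrow> K \<subseteq> seifert_circles"
  unfolding comps_def by (rule classes_subset[OF graph_rel_subset])

lemma finite_comps [simp]: "finite (comps s)"
  by (simp add: comps_def finite_classes)

section \<open>The upper bound\<close>

text \<open>Marks the monomials that reduce, up to sign, to the product of all
  \<open>y\<^sub>K\<close>: the exponent of \<open>y\<^sub>K\<close> is the number of circles of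
  \<open>K\<close> labelled \<open>X\<close>, and \<open>y\<^sub>K\<^sup>2 = 1\<close>.\<close>

definition odd_on_comps :: "nat set set \<Rightarrow> bool" where
  "odd_on_comps S \<longleftrightarrow> (\<forall>K\<in>comps False. odd (card (S \<inter> K)))"

text \<open>The states at the oriented resolution modulo the images of the splittings at the negative
  crossings form the quotient of \<open>\<complex>[x\<^sub>C | C]\<close> by \<open>x\<^sub>C\<^sup>2 = 1\<close> and \<open>x\<^sub>C = - x\<^sub>C'\<close> for adjacent \<open>C\<close>, \<open>C'\<close> in
  \<open>T\<^sup>-\<close>. Substituting \<open>x\<^sub>C = \<delta>\<^sub>C y\<^sub>K\<close> for \<open>C \<in> K\<close>, this functional is the coefficient of the product of
  the \<open>y\<^sub>K\<close> over all components \<open>K\<close>.\<close>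

definition top_coeff :: "chain \<Rightarrow> complex" where
  "top_coeff f = (\<Sum>S\<in>Pow seifert_circles.
     (if odd_on_comps S then \<Prod>C\<in>S. \<delta> (Min C) else 0) * f (neg, S))"

text \<open>Both circles at a negative crossing lie in one component of \<open>T\<^sup>-\<close>,
  where the count keeps its parity.\<close>

lemma odd_on_comps_toggle:
  assumes k: "k \<in> neg" and S: "S \<subseteq> seifert_circles"
  shows "odd_on_comps (toggle (circ neg (ui k)) (circ neg (oi k)) S) \<longleftrightarrow> odd_on_comps S"
proof -
  let ?P = "circ neg (ui k)" and ?Q = "circ neg (oi k)"
  have kN: "k < N" "\<not> pos k" using k by (auto simp: negative_crossings_def)
  have "odd (card (toggle ?P ?Q S \<inter> K)) \<longleftrightarrow> odd (card (S \<inter> K))" if K: "K \<in> comps False" for K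
  proof -
    have PQ: "?P \<in> K \<longleftrightarrow> ?Q \<in> K" using comps_crossing[OF kN(1)] K kN(2) by simp
    have fin: "finite (S \<inter> K)" using finite_subset[OF S finite_circles] by simp
    show ?thesis
    proof (cases "?P \<in> K")
      case True
      then have "toggle ?P ?Q S \<inter> K = toggle ?P ?Q (S \<inter> K)" using PQ by (auto simp: toggle_def)
      then show ?thesis using even_card_toggle[OF fin circles_split(3)[OF k]] by simp
    next
      case False
      then have "toggle ?P ?Q S \<inter> K = S \<inter> K" using PQ by (auto simp: toggle_def)
      then show ?thesis by simp
    qed
  qed
  then show ?thesis unfolding odd_on_comps_def by blast
qed

text \<open>On the two new circles, the entry of a splitting depends only on whether their labels
  agree. Reversing both preserves it but negates the product of the \<open>\<delta>\<close>, which
  are opposite there; so the terms cancel for each \<open>k\<close>.\<close>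

lemma top_coeff_differential: "top_coeff (differential D f) = 0"
proof -
  let ?w = "\<lambda>S. if odd_on_comps S then \<Prod>C\<in>S. \<delta> (Min C) else 0"
  let ?h = "\<lambda>k S. \<Sum>R | R \<subseteq> circles D (neg - {k}) \<and> edge_entry D (neg - {k}, R) (neg, S). f (neg - {k}, R)"
  have "(\<Sum>S\<in>Pow seifert_circles. ?w S * ?h k S) = 0" if k: "k \<in> neg" for k
  proof (rule sum_involution_zero[where g = "toggle (circ neg (ui k)) (circ neg (oi k))"])
    let ?P = "circ neg (ui k)" and ?Q = "circ neg (oi k)"
    have kN: "k < N" "\<not> pos k" using k by (auto simp: negative_crossings_def)
    note c = circles_split[OF k]
    have PQ: "?P \<in> seifert_circles" "?Q \<in> seifert_circles" using kN(1) by auto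
    fix S assume "S \<in> Pow seifert_circles"
    then have "S \<subseteq> seifert_circles" by simp
    then have S: "S \<subseteq> seifert_circles" "finite S" using finite_subset[OF _ finite_circles] by auto
    show "toggle ?P ?Q S \<in> Pow seifert_circles" using S(1) PQ by (auto simp: toggle_def)
    have "edge_entry D (neg - {k}, R) (neg, toggle ?P ?Q S) \<longleftrightarrow> edge_entry D (neg - {k}, R) (neg, S)" for R
    proof -
      have "?P \<notin> circles D (neg - {k})" "?Q \<notin> circles D (neg - {k})" using c(2) by blast+
      then have "C \<in> toggle ?P ?Q S \<longleftrightarrow> C \<in> S" if "C \<in> circles D (neg - {k}) \<inter> seifert_circles" for C
        using that by (auto simp: toggle_iff)
      then show ?thesis unfolding edge_entry_split[OF c] by (simp add: toggle_iff)
    qed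
    then have h: "?h k (toggle ?P ?Q S) = ?h k S" by simp
    have "\<delta> (Min ?P) = \<delta> (ui k)" "\<delta> (Min ?Q) = \<delta> (oi k)"
      using labelling_circle[OF labelling_delta] PQ by auto
    then have d: "\<delta> (Min ?Q) = - \<delta> (Min ?P)" using delta_crossing[OF kN(1)] by simp
    have "\<delta> (Min C) * \<delta> (Min C) = 1" for C by (simp add: \<delta>_def)
    then have "(\<Prod>C\<in>toggle ?P ?Q S. \<delta> (Min C)) = - (\<Prod>C\<in>S. \<delta> (Min C))"
      using prod_toggle[OF S(2) c(3), of "\<lambda>C. \<delta> (Min C)"] d by simp
    then show "?w (toggle ?P ?Q S) * ?h k (toggle ?P ?Q S) = - (?w S * ?h k S)"
      unfolding h odd_on_comps_toggle[OF k S(1)] by simp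
  qed simp
  then have z: "(- 1) ^ card {l \<in> neg. l < k} * (\<Sum>S\<in>Pow seifert_circles. ?w S * ?h k S) = 0"
    if "k \<in> neg" for k using that by simp
  have st: "(neg, S) \<in> states D" if "S \<in> Pow seifert_circles" for S
    using that by (auto simp: states_def negative_crossings_def)
  have "top_coeff (differential D f) = (\<Sum>S\<in>Pow seifert_circles. \<Sum>k\<in>neg.
      (- 1) ^ card {l \<in> neg. l < k} * (?w S * ?h k S))"
    unfolding top_coeff_def
    by (intro sum.cong) (auto simp: differential_def st sum_distrib_left mult.left_commute intro!: sum.cong)
  also have "\<dots> = (\<Sum>k\<in>neg. (- 1) ^ card {l \<in> neg. l < k} * (\<Sum>S\<in>Pow seifert_circles. ?w S * ?h k S))"
    by (subst sum.swap) (simp add: sum_distrib_left)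
  also have "\<dots> = 0" using z by (intro sum.neutral) blast
  finally show ?thesis .
qed

text \<open>The \<open>\<delta>\<close> of the functional on \<open>S\<close> and those of the
  generator off \<open>S\<close> multiply to the same sign for every \<open>S\<close>. Nothing
  cancels, and one admissible set suffices.\<close>

lemma top_coeff_canonical: "top_coeff (canonical_generator D) \<noteq> 0"
proof -
  let ?A = "{S \<in> Pow seifert_circles. odd_on_comps S}"
  have "(\<Prod>C\<in>S. \<delta> (Min C)) * weight D neg \<delta> S = (\<Prod>C\<in>seifert_circles. \<delta> (Min C))"
    if S: "S \<subseteq> seifert_circles" for S
  proof -
    have "(\<Prod>C\<in>S. \<delta> (Min C)) = (\<Prod>C\<in>seifert_circles. if C \<in> S then \<delta> (Min C) else 1)"
      using S by (simp add: Int_absorb1 flip: prod.inter_restrict)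
    then show ?thesis by (auto simp: weight_def simp flip: prod.distrib intro!: prod.cong)
  qed
  then have "top_coeff (canonical_generator D) =
      (\<Sum>S\<in>Pow seifert_circles. if odd_on_comps S then \<Prod>C\<in>seifert_circles. \<delta> (Min C) else 0)"
    unfolding top_coeff_def canonical_generator_eq by (intro sum.cong) (auto simp: tensor_def)
  also have "\<dots> = of_nat (card ?A) * (\<Prod>C\<in>seifert_circles. \<delta> (Min C))"
    by (simp add: sum.inter_filter[symmetric] del: Pow_iff)
  finally have eq: "top_coeff (canonical_generator D) = of_nat (card ?A) * (\<Prod>C\<in>seifert_circles. \<delta> (Min C))" .
  have "\<exists>C. C \<in> K" if "K \<in> comps False" for K
    using that classes_nonempty unfolding comps_def by blast
  \<comment> \<open>One representative of each component yields such a set.\<close>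
  then obtain r where r: "\<And>K. K \<in> comps False \<Longrightarrow> r K \<in> K" by metis
  have "odd_on_comps (r ` comps False)"
    unfolding odd_on_comps_def
  proof
    fix K assume K: "K \<in> comps False"
    have "r ` comps False \<inter> K = {r K}"
      using r K classes_disjoint[of _ seifert_circles "graph_rel False"] unfolding comps_def by blast
    then show "odd (card (r ` comps False \<inter> K))" by simp
  qed
  moreover have "r ` comps False \<subseteq> seifert_circles" using r comps_subset by blast
  ultimately have "?A \<noteq> {}" by blast
  then have "card ?A \<noteq> 0" by simp
  moreover have "(\<Prod>C\<in>seifert_circles. \<delta> (Min C)) \<noteq> 0" by (simp add: \<delta>_def)
  ultimately show ?thesis unfolding eq by simp
qed

lemma card_complement:
  assumes "S \<subseteq> seifert_circles"
  shows "int (card (seifert_circles - S)) = int (card seifert_circles) - int (card S)"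
  using card_Diff_subset[of S seifert_circles] card_mono[of seifert_circles S] assms
  by (simp add: finite_subset of_nat_diff)

text \<open>\<open>top_coeff\<close> kills boundaries, so any representative involves a state over
  \<open>neg\<close> with an \<open>X\<close> in each component of \<open>T\<^sup>-\<close>. Each
  \<open>X\<close> lowers the quantum degree by 2 from its maximum, the number of circles plus the
  writhe.\<close>

lemma filtration_upper_bound:
  assumes "homology_class D 0 (canonical_generator D) \<in> filtered_homology D j 0"
  shows "j \<le> int (card seifert_circles) - 2 * int (card (comps False)) + writhe D"
proof -
  obtain z where z: "z \<in> filtered_chains D j 0"
      "homology_class D 0 (canonical_generator D) = homology_class D 0 z"
    using assms by (auto simp: filtered_homology_def)
  then obtain b where b: "b \<in> boundaries D 0" "z = (\<lambda>\<sigma>. canonical_generator D \<sigma> + b \<sigma>)"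
    using in_homology_class[of z D 0] by (auto simp: homology_class_def)
  have "top_coeff z = top_coeff (canonical_generator D) + top_coeff b"
    unfolding b(2) top_coeff_def by (simp add: distrib_left sum.distrib)
  moreover have "top_coeff b = 0" using b(1) top_coeff_differential by (auto simp: boundaries_def)
  ultimately have "top_coeff z \<noteq> 0" using top_coeff_canonical by simp
  then obtain S where "S \<in> Pow seifert_circles"
      "(if odd_on_comps S then \<Prod>C\<in>S. \<delta> (Min C) else 0) * z (neg, S) \<noteq> 0"
    unfolding top_coeff_def by (rule sum.not_neutral_contains_not_neutral)
  then have S: "S \<subseteq> seifert_circles" "odd_on_comps S" "z (neg, S) \<noteq> 0" by (auto split: if_splits)
  have "card (comps False) \<le> card S"
  proof (rule card_classes_le)
    show "finite S" using finite_subset[OF S(1) finite_circles] .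
    show "K \<inter> S \<noteq> {}" if "K \<in> comps False" for K
      using S(2) that by (auto simp: odd_on_comps_def Int_commute)
    show "comps False \<subseteq> classes seifert_circles (graph_rel False)" by (simp add: comps_def)
  qed
  moreover have "j \<le> qdeg D (neg, S)" using z(1) S(3) unfolding filtered_chains_def by blast
  ultimately show ?thesis using card_complement[OF S(1)] by simp
qed

section \<open>The lower bound\<close>

definition comp :: "nat \<Rightarrow> nat set set" where
  "comp e = cls (graph_rel True) (circ neg e)"

text \<open>Reversing the signs of Lee's generator on the components in \<open>\<Theta>\<close> of \<open>T\<^sup>+\<close>.\<close>

definition twist :: "nat set set set \<Rightarrow> nat \<Rightarrow> complex" where
  "twist \<Theta> e = \<delta> e * (if comp e \<in> \<Theta> then - 1 else 1)"

lemma comp_in_comps: "e \<in> arcs D \<Longrightarrow> comp e \<in> comps True"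
  by (simp add: comp_def comps_def cls_in_classes)

lemma comp_eq_iff:
  assumes "K \<in> comps True" "C \<in> seifert_circles"
  shows "comp (Min C) = K \<longleftrightarrow> C \<in> K"
proof -
  have "circ neg (Min C) = C" using circles_circ[OF assms(2) Min_in_circle[OF assms(2)]] by simp
  then have eq: "comp (Min C) = cls (graph_rel True) C" by (simp add: comp_def)
  show ?thesis
  proof
    assume "comp (Min C) = K"
    then show "C \<in> K" unfolding eq by (metis cls_iff conn_refl)
  next
    assume "C \<in> K"
    then show "comp (Min C) = K" unfolding eq using assms(1) by (metis classes_cls comps_def)
  qed
qed

lemma comp_strand: "k < N \<Longrightarrow> comp (oo k) = comp (ui k)" "k < N \<Longrightarrow> comp (uo k) = comp (oi k)"
  using seifert_strand by (simp_all add: comp_def)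

lemma comp_positive:
  assumes "k < N" "pos k"
  shows "comp (oi k) = comp (ui k)"
proof -
  have "(circ neg (oi k), circ neg (ui k)) \<in> graph_rel True"
    using assms by (auto simp: graph_rel_def)
  then show ?thesis unfolding comp_def cls_eq_iff by (rule conn_base)
qed

lemma labelling_twist: "labelling neg (twist \<Theta>)"
  using labelling_delta comp_strand by (auto simp: labelling_def twist_def rel_neg)

lemma twist_positive: "k < N \<Longrightarrow> pos k \<Longrightarrow> twist \<Theta> (oi k) = - twist \<Theta> (ui k)"
  using comp_positive delta_crossing by (simp add: twist_def)

text \<open>Along the knot from \<open>e\<close> to \<open>e'\<close> membership in
  \<open>\<Theta>\<close> changes at some crossing. Positive crossings stay within a component of
  \<open>T\<^sup>+\<close>, so it is negative; reversing one of two opposite labels makes them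
  equal.\<close>

lemma twist_boundary:
  assumes "e \<in> arcs D" "e' \<in> arcs D" "comp e \<in> \<Theta>" "comp e' \<notin> \<Theta>"
  shows "tensor D neg (twist \<Theta>) \<in> boundaries D 0"
proof -
  have "\<exists>k<N. (comp (ui k) \<in> \<Theta>) \<noteq> (comp (oi k) \<in> \<Theta>)"
  proof (rule ccontr)
    assume no: "\<not> ?thesis"
    have "(comp e \<in> \<Theta>) = (comp e' \<in> \<Theta>)"
      by (rule arcs_connected[OF _ _ assms(1,2)]) (use no comp_strand in auto)
    then show False using assms by simp
  qed
  then obtain k where k: "k < N" "(comp (ui k) \<in> \<Theta>) \<noteq> (comp (oi k) \<in> \<Theta>)" by blast
  then have "k \<in> neg" using comp_positive in_neg_iff by metis
  moreover have "twist \<Theta> (oi k) = twist \<Theta> (ui k)"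
    using k delta_crossing by (auto simp: twist_def)
  ultimately show ?thesis using tensor_boundary[OF labelling_twist twist_positive] by blast
qed

text \<open>Reversing \<open>K\<close> multiplies the weight by \<open>- 1\<close> for each circle
  of \<open>K\<close> labelled \<open>One\<close>.\<close>

lemma weight_twist_toggle:
  assumes K: "K \<in> comps True" "even (card (K - S))"
  shows "weight D neg (twist (toggle K K \<Theta>)) S = weight D neg (twist \<Theta>) S"
proof -
  have "weight D neg (twist (toggle K K \<Theta>)) S =
      (\<Prod>C\<in>seifert_circles. (if C \<in> S then 1 else twist \<Theta> (Min C)) * (if C \<in> K - S then - 1 else 1))"
    unfolding weight_def using comp_eq_iff[OF K(1)]
    by (intro prod.cong) (auto simp: twist_def toggle_iff)
  also have "\<dots> = weight D neg (twist \<Theta>) S * (\<Prod>C\<in>seifert_circles. if C \<in> K - S then - 1 else 1)"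
    by (simp add: weight_def prod.distrib)
  also have "(\<Prod>C\<in>seifert_circles. if C \<in> K - S then - 1 else (1::complex)) = (- 1) ^ card (K - S)"
  proof -
    have "seifert_circles \<inter> (K - S) = K - S" using comps_subset[OF K(1)] by blast
    then show ?thesis using prod.inter_restrict[of seifert_circles "\<lambda>_. - 1 :: complex" "K - S"] by simp
  qed
  finally show ?thesis using K(2) by simp
qed

text \<open>The chain \<open>z\<close> is a tensor product over the components of
  \<open>T\<^sup>+\<close>: for \<open>K \<in> \<K>\<close> the factor is the part of the generator
  on \<open>K\<close> minus its reversal. Only states with an odd number of \<open>One\<close> on
  each such \<open>K\<close> survive, which bounds the quantum degree from below.\<close>

lemma filtration_lower_bound:
  "homology_class D 0 (canonical_generator D) \<in>
    filtered_homology D (2 * int (card (comps True)) - 2 - int (card seifert_circles) + writhe D) 0"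
proof -
  have arc0: "0 \<in> arcs D" by (simp add: arcs_def)
  \<comment> \<open>One component stays unreversed, so that every nonempty \<open>\<Theta>\<close>
    reverses some but not all components and gives a boundary.\<close>
  define K0 where "K0 = comp 0"
  have K0: "K0 \<in> comps True" using comp_in_comps[OF arc0] by (simp add: K0_def)
  define \<K> where "\<K> = comps True - {K0}"
  have fin: "finite (Pow \<K>)" by (simp add: \<K>_def)
  define c :: "nat set set set \<Rightarrow> complex" where "c \<Theta> = (- 1) ^ card \<Theta>" for \<Theta>
  let ?t = "\<lambda>\<Theta>. tensor D neg (twist \<Theta>)"
  define z where "z = (\<lambda>\<sigma>. \<Sum>\<Theta>\<in>Pow \<K>. c \<Theta> * ?t \<Theta> \<sigma>)"
  define b where "b = (\<lambda>\<sigma>. \<Sum>\<Theta>\<in>Pow \<K> - {{}}. c \<Theta> * ?t \<Theta> \<sigma>)"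
  have b: "b \<in> boundaries D 0"
    unfolding b_def
  proof (rule boundaries_linear)
    fix \<Theta> assume \<Theta>: "\<Theta> \<in> Pow \<K> - {{}}"
    then obtain K where K: "K \<in> \<Theta>" "K \<in> comps True" by (auto simp: \<K>_def)
    then obtain C where C: "C \<in> seifert_circles" "C \<in> K"
      using classes_nonempty unfolding comps_def by blast
    then have "comp (Min C) \<in> \<Theta>" using comp_eq_iff[OF K(2) C(1)] K(1) by simp
    moreover have "Min C \<in> arcs D" using Min_in_circle[OF C(1)] circle_subset[OF C(1)] by blast
    moreover have "comp 0 \<notin> \<Theta>" using \<Theta> by (auto simp: \<K>_def K0_def)
    ultimately show "?t \<Theta> \<in> boundaries D 0" using twist_boundary arc0 by blast
  qed (use fin in simp)
  have "twist {} = \<delta>" by (simp add: twist_def fun_eq_iff)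
  then have zb: "z = (\<lambda>\<sigma>. canonical_generator D \<sigma> + b \<sigma>)"
    unfolding z_def b_def canonical_generator_eq using fin
    by (subst sum.remove[of _ "{}"]) (auto simp: c_def)
  have chain: "z \<in> chains D 0" unfolding z_def by (rule chains_linear) (rule tensor_chain)
  have "differential D (?t \<Theta>) = (\<lambda>_. 0)" for \<Theta>
    using tensor_cycle[OF labelling_twist twist_positive] by blast
  then have "differential D z = (\<lambda>_. 0)"
    unfolding z_def differential_linear[OF fin] by simp
  then have cycle: "z \<in> cycles D 0" using chain by (simp add: cycles_def)
  have "2 * int (card (comps True)) - 2 - int (card seifert_circles) + writhe D \<le> qdeg D \<sigma>"
    if nz: "z \<sigma> \<noteq> 0" for \<sigma>
  proof -
    obtain \<Theta> where "c \<Theta> * ?t \<Theta> \<sigma> \<noteq> 0"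
      using nz unfolding z_def by (rule sum.not_neutral_contains_not_neutral)
    then have "?t \<Theta> \<sigma> \<noteq> 0" by simp
    then obtain S where S: "\<sigma> = (neg, S)" "S \<subseteq> seifert_circles"
      by (cases \<sigma>) (auto simp: tensor_def split: if_splits)
    have "odd (card (K - S))" if K: "K \<in> \<K>" for K
    proof (rule ccontr)
      assume even: "\<not> odd (card (K - S))"
      have KT: "K \<in> comps True" using K by (simp add: \<K>_def)
      have "z \<sigma> = 0"
        unfolding z_def
      \<comment> \<open>Toggling \<open>K\<close> in \<open>\<Theta>\<close> changes the sign
        \<open>c\<close> but, for an even number of \<open>One\<close> on \<open>K\<close>, not the
        weight.\<close>
      proof (rule sum_involution_zero[where g = "toggle K K"])
        fix \<Theta> assume \<Theta>: "\<Theta> \<in> Pow \<K>"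
        then show "toggle K K \<Theta> \<in> Pow \<K>" using K by (auto simp: toggle_def)
        have f: "finite \<Theta>"
          by (rule finite_subset[OF _ finite_comps[of True]]) (use \<Theta> in \<open>auto simp: \<K>_def\<close>)
        have "c (toggle K K \<Theta>) = - c \<Theta>"
        proof (cases "K \<in> \<Theta>")
          case True
          then have "toggle K K \<Theta> = \<Theta> - {K}" by (auto simp: toggle_def)
          moreover have "card \<Theta> = Suc (card (\<Theta> - {K}))" using card_Suc_Diff1[OF f True] by (rule sym)
          ultimately show ?thesis by (simp add: c_def)
        next
          case False
          then have "toggle K K \<Theta> = insert K \<Theta>" by (auto simp: toggle_def)
          then show ?thesis using False f by (simp add: c_def)
        qed
        moreover have "?t (toggle K K \<Theta>) \<sigma> = ?t \<Theta> \<sigma>"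
          using weight_twist_toggle[OF KT] even by (simp add: S tensor_def)
        ultimately show "c (toggle K K \<Theta>) * ?t (toggle K K \<Theta>) \<sigma> = - (c \<Theta> * ?t \<Theta> \<sigma>)" by simp
      qed simp
      then show False using nz by simp
    qed
    then have ne: "K - S \<noteq> {}" if "K \<in> \<K>" for K using that by (metis card.empty dvd_0_right)
    have "card \<K> \<le> card (seifert_circles - S)"
    proof (rule card_classes_le)
      show "K \<inter> (seifert_circles - S) \<noteq> {}" if "K \<in> \<K>" for K
        using ne[OF that] comps_subset[of K True] that by (auto simp: \<K>_def)
      show "\<K> \<subseteq> classes seifert_circles (graph_rel True)" by (auto simp: \<K>_def comps_def)
    qed simp
    moreover have "int (card \<K>) = int (card (comps True)) - 1"
      using card_Suc_Diff1[OF finite_comps K0] unfolding \<K>_def by linarith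
    ultimately show ?thesis using card_complement[OF S(2)] by (simp add: S(1))
  qed
  then have "z \<in> filtered_chains D (2 * int (card (comps True)) - 2 - int (card seifert_circles) + writhe D) 0"
    using chain unfolding filtered_chains_def by blast
  moreover have "homology_class D 0 (canonical_generator D) = homology_class D 0 z"
    unfolding zb using homology_class_eq[OF b] by simp
  ultimately show ?thesis unfolding filtered_homology_def using cycle by blast
qed

end

text \<open>On the integers \<open>GREATEST\<close> is a maximum only if one exists; a witness and
  an upper bound reduce it to the \<open>Max\<close> of a finite set.\<close>

lemma Greatest_int:
  fixes P :: "int \<Rightarrow> bool"
  assumes "P a" "\<And>j. P j \<Longrightarrow> j \<le> b"
  shows "P (GREATEST j. P j)" "a \<le> (GREATEST j. P j)"
proof -
  let ?A = "{j. P j \<and> a \<le> j}"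
  have A: "finite ?A" "a \<in> ?A" using assms by (auto intro: finite_subset[of _ "{a..b}"])
  then have M: "Max ?A \<in> ?A" "a \<le> Max ?A" using Max_in[of ?A] by auto
  have "(GREATEST j. P j) = Max ?A"
  proof (rule Greatest_equality)
    show "P (Max ?A)" using M by simp
    fix j assume "P j"
    show "j \<le> Max ?A"
    proof (cases "a \<le> j")
      case True
      with \<open>P j\<close> show ?thesis by (intro Max_ge[OF A(1)]) simp
    next
      case False
      with M(2) show ?thesis by linarith
    qed
  qed
  then show "P (GREATEST j. P j)" "a \<le> (GREATEST j. P j)" using M by auto
qed

theorem theorem1p10:
  fixes D :: diagram
  assumes "knot_diagram D"
  shows "(Delta_defect D = 0 \<longrightarrow> rasmussen_s D = U_bound D) \<and>
         U_bound D - 2 * Delta_defect D \<le> rasmussen_s D \<and> rasmussen_s D \<le> U_bound D"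
proof -
  interpret knot_code D by standard (rule assms)
  note s = Greatest_int[of "\<lambda>j. homology_class D 0 (canonical_generator D) \<in> filtered_homology D j 0",
      OF filtration_lower_bound filtration_upper_bound]
  \<comment> \<open>The final 1 in \<open>U_bound\<close> is the shift from \<open>s_min\<close> to
    \<open>rasmussen_s\<close>.\<close>
  have "rasmussen_s D \<le> U_bound D"
    using filtration_upper_bound[OF s(1)]
    by (simp add: rasmussen_s_def s_min_def U_bound_def components_eq nodes_eq)
  \<comment> \<open>The components of \<open>T\<^sup>-\<close> cancel on the left; what remains is
    the level of \<open>filtration_lower_bound\<close> plus 1.\<close>
  moreover have "U_bound D - 2 * Delta_defect D \<le> rasmussen_s D"
    using s(2)
    by (simp add: rasmussen_s_def s_min_def U_bound_def Delta_defect_def components_eq nodes_eq)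
  ultimately show ?thesis by auto
qed

end
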